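(* Let $E$ be a Banach lattice such that both $E$ and its dual $E^*$ are order continuous. If $E$ admits a countable positively norming set, then $E$ is separable.
   Context: All Banach spaces are real. For a Banach lattice $E$, $E^+=\{x\in E: x\ge 0\}$, $B_{E^*}$ is the closed unit ball of the dual $E^*$, and $(E^* )^+$ is the positive cone of the dual Banach lattice. A set $B\subseteq B_{E^*}\cap (E^* )^+$ is said to be positively norming if there is a constant $c>0$ such that $\|x\|_E\le c\,\sup_{\varphi\in B}\varphi(|x|)$ for every $x\in E$. A Banach lattice is order continuous if its norm is order continuous. *)

theory Defs
  imports "HOL-Analysis.Analysis" "HOL-Library.Lattice_Algebras"
begin

class banach_lattice = banach + ordered_real_vector + lattice_ab_group_add_abs +
  assumes norm_lattice: "\<bar>x\<bar> \<le> \<bar>y\<bar> \<Longrightarrow> norm x \<le> norm y"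

instance real :: banach_lattice
  by standard (auto simp: abs_if sup_real_def)

(* The relation le is a parameter because the dual is represented by bounded linear functions,
   on which the library provides no order. The norm net indexed by a set directed downwards
   to 0 converges to 0. *)
definition order_continuous_norm :: "('b::real_normed_vector \<Rightarrow> 'b \<Rightarrow> bool) \<Rightarrow> bool" where
  "order_continuous_norm le \<longleftrightarrow>
    (\<forall>D. D \<noteq> {} \<and>
         (\<forall>x\<in>D. \<forall>y\<in>D. \<exists>z\<in>D. le z x \<and> le z y) \<and>
         (\<forall>x\<in>D. le 0 x) \<and> (\<forall>b. (\<forall>x\<in>D. le b x) \<longrightarrow> le b 0)
       \<longrightarrow> (\<forall>e>0. \<exists>x\<in>D. \<forall>y\<in>D. le y x \<longrightarrow> norm y < e))"

definition dual_le :: "('a::banach_lattice \<Rightarrow>\<^sub>L real) \<Rightarrow> ('a \<Rightarrow>\<^sub>L real) \<Rightarrow> bool" where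
  "dual_le \<phi> \<psi> \<longleftrightarrow> (\<forall>x\<ge>0. blinfun_apply \<phi> x \<le> blinfun_apply \<psi> x)"

(* B is required to be nonempty because the supremum of the empty set is unspecified on the
   reals. Only the zero space could have an empty norming set, and there {0} is norming as well. *)
definition positively_norming :: "('a::banach_lattice \<Rightarrow>\<^sub>L real) set \<Rightarrow> bool" where
  "positively_norming B \<longleftrightarrow>
    B \<noteq> {} \<and> B \<subseteq> cball 0 1 \<inter> {\<phi>. dual_le 0 \<phi>} \<and>
    (\<exists>c>0. \<forall>x. norm x \<le> c * (SUP \<phi>\<in>B. blinfun_apply \<phi> \<bar>x\<bar>))"

end

theory Submission
  imports Defs
begin

text \<open>Suppose that the lattice is not separable. Summing the countable norming set \<open>B\<close> with weights
  gives a strictly positive functional \<open>\<phi>\<close>, and order continuity of the norm makes \<open>\<phi>\<close> control the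
  norm on order intervals (\<open>strictly_positive_norm_small\<close>). Order continuity of the dual norm
  forbids bounded disjoint sequences on which some positive functional is bounded away from 0
  (\<open>dual_order_continuous_disjoint_small\<close>). The proof constructs such a sequence.

  The first step is an exhaustion argument: there is an element \<open>u > 0\<close> such that \<open>[0, v]\<close> is not
  separable whenever \<open>0 < v \<le> u\<close> (\<open>ex_nowhere_separable\<close>). For such \<open>v\<close> no countable set of
  functionals separates the points of \<open>[-v, v]\<close> (\<open>separating_imp_separable_interval\<close>), so some
  \<open>h \<noteq> 0\<close> in \<open>[-v, v]\<close> is annihilated by all members of \<open>B\<close>. An extreme point argument improves
  this to the existence of \<open>z\<close> with \<open>\<bar>z\<bar> = v\<close> annihilated by \<open>B\<close> (\<open>ex_annihilated_abs_eq\<close>); its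
  positive and negative parts split \<open>v\<close> into disjoint pieces on which each member of \<open>B\<close> has half
  of its value at \<open>v\<close>. Splitting repeatedly, always within the positive part, and multiplying the
  negative part of step \<open>k\<close> by \<open>2 ^ k\<close>, with \<open>k\<close> counted from 1, gives a disjoint sequence at
  which each member of \<open>B\<close> takes the same value as at \<open>u\<close>. As \<open>B\<close> is norming, the sequence is
  bounded, and some member of \<open>B\<close> does not vanish at \<open>u\<close>: a contradiction.

  Both the separation step and the extreme points rest on a compactness property of order
  intervals, usually obtained from their weak compactness: a chain of nonempty closed convex
  subsets of \<open>[-u, u]\<close> has nonempty intersection. It is proved by minimising a strictly convex
  function built from \<open>\<phi>\<close> and the lattice operations
  (\<open>chain_closed_midpoint_closed_Inter_nonempty\<close>).\<close>

section \<open>Vector lattice identities and continuity of the lattice operations\<close>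

lemma lattice_group_inf_sup_distrib:
  fixes a b c :: "'a::lattice_ab_group_add"
  shows "inf a (sup b c) = sup (inf a b) (inf a c)"
proof (rule order.antisym)
  let ?m = "sup (inf a b) (inf a c)"
  have bound: "x \<le> ?m - a + sup a (sup b c)" if "x \<le> sup b c" "inf a x \<le> ?m" for x
  proof -
    have "x = inf a x - a + sup a x"
      using add_eq_inf_sup[of a x] by (simp add: algebra_simps)
    also have "\<dots> \<le> ?m - a + sup a (sup b c)"
      using that by (intro add_mono diff_mono sup_mono) auto
    finally show ?thesis .
  qed
  have "sup b c \<le> ?m - a + sup a (sup b c)"
    by (rule sup_least) (rule bound; simp)+
  moreover have "inf a (sup b c) = a + sup b c - sup a (sup b c)"
    by (metis add_diff_cancel_left' add_eq_inf_sup)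
  ultimately have "inf a (sup b c) \<le> a + (?m - a + sup a (sup b c)) - sup a (sup b c)"
    by (metis add_left_mono diff_right_mono)
  then show "inf a (sup b c) \<le> ?m"
    by (simp only: algebra_simps) simp
next
  show "sup (inf a b) (inf a c) \<le> inf a (sup b c)"
    by (auto intro: le_infI1 le_infI2 le_supI1 le_supI2)
qed

text \<open>Subadditivity of \<open>inf\<close> in its first argument. It makes \<open>inf x (m w)\<close> additive in
  \<open>x \<ge> 0\<close> in the limit of large \<open>m\<close>.\<close>
lemma inf_add_le:
  fixes a b c :: "'a::lattice_ab_group_add"
  assumes "0 \<le> a" "0 \<le> b" "0 \<le> c"
  shows "inf (a + b) c \<le> inf a c + inf b c"
proof -
  let ?x = "inf (a + b) c"
  have le: "?x \<le> c" "?x \<le> a + b" by (rule inf_le2, rule inf_le1)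
  have "?x - a \<le> b" using le by (simp only: diff_le_eq add.commute)
  moreover have "?x - a \<le> c" "?x - c \<le> b" "?x - c \<le> c"
    using le assms by (auto simp only: diff_le_eq intro: order_trans add_increasing2 add_increasing)
  ultimately have 1: "?x - a \<le> b" "?x - a \<le> c" "?x - c \<le> b" "?x - c \<le> c"
    by blast+
  have "?x - inf a c = sup (?x - a) (?x - c)"
    by (simp only: diff_inf_eq_sup add_sup_distrib_left) simp
  also have "\<dots> \<le> inf b c"
    using 1 by (intro sup_least inf_greatest)
  finally show ?thesis by (metis diff_le_eq add.commute)
qed

lemma pprt_minus_pprt: "pprt x - pprt (- x) = (x::'a::lattice_ab_group_add)"
  using prts[of x] by (simp only: pprt_neg) simp

lemma pprt_plus_pprt: "pprt x + pprt (- x) = \<bar>x::'a::lattice_ab_group_add_abs\<bar>"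
  by (simp add: abs_prts pprt_neg)

lemma pprt_le_abs: "pprt x \<le> \<bar>x::'a::lattice_ab_group_add_abs\<bar>"
  using pprt_plus_pprt[of x] by (metis add_increasing2 order_refl zero_le_pprt)

lemma pprt_disjoint: "inf (pprt x) (pprt (- x)) = (0::'a::lattice_ab_group_add)"
proof -
  have "inf (pprt x) (pprt (- x)) = inf (x - nprt x) (0 - nprt x)"
    using prts[of x] by (simp only: pprt_neg diff_0) (metis add_diff_cancel_right')
  also have "\<dots> = nprt x - nprt x"
    unfolding nprt_def diff_conv_add_uminus by (simp only: add_inf_distrib_right)
  finally show ?thesis by simp
qed

lemma scaleR_inf_distrib:
  fixes a b :: "'a::banach_lattice"
  assumes "0 \<le> r"
  shows "r *\<^sub>R inf a b = inf (r *\<^sub>R a) (r *\<^sub>R b)"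
proof (cases "r = 0")
  case False
  with assms have r: "r > 0" by simp
  show ?thesis
  proof (rule order.antisym)
    have *: "(1 / r) *\<^sub>R inf (r *\<^sub>R a) (r *\<^sub>R b) \<le> (1 / r) *\<^sub>R (r *\<^sub>R a)"
         "(1 / r) *\<^sub>R inf (r *\<^sub>R a) (r *\<^sub>R b) \<le> (1 / r) *\<^sub>R (r *\<^sub>R b)"
      using r by (intro scaleR_left_mono; simp)+
    then have "(1 / r) *\<^sub>R inf (r *\<^sub>R a) (r *\<^sub>R b) \<le> inf a b"
      using r by simp
    then have "r *\<^sub>R ((1 / r) *\<^sub>R inf (r *\<^sub>R a) (r *\<^sub>R b)) \<le> r *\<^sub>R inf a b"
      using r by (intro scaleR_left_mono) auto
    then show "inf (r *\<^sub>R a) (r *\<^sub>R b) \<le> r *\<^sub>R inf a b" using r by simp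
  qed (use assms in \<open>auto intro: scaleR_left_mono\<close>)
qed simp

lemma disjoint_scaleR:
  fixes a b :: "'a::banach_lattice"
  assumes "0 \<le> a" "0 \<le> b" "inf a b = 0" "0 \<le> r"
  shows "inf (r *\<^sub>R a) b = 0"
proof (rule order.antisym)
  let ?R = "max 1 r"
  have "inf (r *\<^sub>R a) b \<le> inf (?R *\<^sub>R a) (?R *\<^sub>R b)"
    using scaleR_right_mono[of r ?R a] scaleR_right_mono[of 1 ?R b] assms
    by (intro inf_mono) auto
  also have "\<dots> = 0"
    using scaleR_inf_distrib[of ?R a b] assms by simp
  finally show "inf (r *\<^sub>R a) b \<le> 0" .
qed (use assms in \<open>auto intro: scaleR_nonneg_nonneg\<close>)

text \<open>A lattice version of the parallelogram law: the second difference of the modulus at \<open>p\<close> in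
  direction \<open>d\<close> is nonnegative, and it is large where \<open>\<bar>d\<bar>\<close> exceeds \<open>\<bar>p\<bar>\<close>.\<close>
lemma abs_parallelogram_ge:
  fixes p d :: "'a::banach_lattice"
  shows "2 *\<^sub>R pprt (\<bar>d\<bar> - \<bar>p\<bar>) \<le> \<bar>p + d\<bar> + \<bar>p - d\<bar> - 2 *\<^sub>R \<bar>p\<bar>"
proof -
  let ?X = "\<bar>p + d\<bar> + \<bar>p - d\<bar> - 2 *\<^sub>R \<bar>p\<bar>"
  have abs2: "\<bar>2 *\<^sub>R x\<bar> = 2 *\<^sub>R \<bar>x\<bar>" for x :: 'a
  proof -
    have eq: "\<bar>y\<bar> = - inf (- y) y" for y :: 'a
      by (simp add: abs_lattice)
    have "\<bar>2 *\<^sub>R x\<bar> = - inf (2 *\<^sub>R (- x)) (2 *\<^sub>R x)"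
      by (simp only: eq scaleR_minus_right)
    also have "\<dots> = 2 *\<^sub>R (- inf (- x) x)"
      using scaleR_inf_distrib[of 2 "- x" x] by (simp only: scaleR_minus_right zero_le_numeral)
    also have "\<dots> = 2 *\<^sub>R \<bar>x\<bar>"
      by (simp only: eq)
    finally show ?thesis .
  qed
  have "\<bar>2 *\<^sub>R p\<bar> \<le> \<bar>p + d\<bar> + \<bar>p - d\<bar>"
    using abs_triangle_ineq[of "p + d" "p - d"] by (simp add: scaleR_2)
  then have 1: "0 \<le> ?X" by (simp add: abs2)
  have "\<bar>2 *\<^sub>R d\<bar> \<le> \<bar>p + d\<bar> + \<bar>p - d\<bar>"
    using abs_triangle_ineq4[of "p + d" "p - d"] by (simp add: scaleR_2)
  then have 2: "2 *\<^sub>R (\<bar>d\<bar> - \<bar>p\<bar>) \<le> ?X" by (simp add: abs2 scaleR_diff_right)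
  have h: "(1/2) *\<^sub>R x \<le> (1/2) *\<^sub>R ?X" if "x \<le> ?X" for x
    using that by (intro scaleR_left_mono) auto
  have "pprt (\<bar>d\<bar> - \<bar>p\<bar>) \<le> (1/2) *\<^sub>R ?X"
    unfolding pprt_def using h[OF 1] h[OF 2] by simp
  then have "2 *\<^sub>R pprt (\<bar>d\<bar> - \<bar>p\<bar>) \<le> 2 *\<^sub>R ((1/2) *\<^sub>R ?X)"
    by (intro scaleR_left_mono) auto
  then show ?thesis by simp
qed

lemma norm_abs_lattice [simp]: "norm \<bar>x::'a::banach_lattice\<bar> = norm x"
  by (intro order.antisym norm_lattice) auto

lemma norm_mono_nonneg: "0 \<le> x \<Longrightarrow> x \<le> y \<Longrightarrow> norm x \<le> norm (y::'a::banach_lattice)"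
  by (rule norm_lattice) (simp add: order_trans)

lemma norm_abs_diff_le: "norm (\<bar>x\<bar> - \<bar>y\<bar>) \<le> norm (x - y::'a::banach_lattice)"
  by (rule norm_lattice) (rule abs_triangle_ineq3)

lemma tendsto_abs_lattice:
  fixes f :: "'b \<Rightarrow> 'a::banach_lattice"
  assumes "(f \<longlongrightarrow> l) F"
  shows "((\<lambda>x. \<bar>f x\<bar>) \<longlongrightarrow> \<bar>l\<bar>) F"
proof -
  have "((\<lambda>x. norm (f x - l)) \<longlongrightarrow> 0) F"
    using assms tendsto_dist_iff[of f l F] by (simp add: dist_norm)
  then have "((\<lambda>x. \<bar>f x\<bar> - \<bar>l\<bar>) \<longlongrightarrow> 0) F"
    by (rule Lim_null_comparison[rotated]) (simp add: norm_abs_diff_le)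
  then show ?thesis by (simp add: LIM_zero_iff)
qed

lemma inf_eq_pprt: "inf a b = a - pprt (a - b::'a::lattice_ab_group_add)"
proof -
  have "a - pprt (a - b) = a + inf (b - a) 0"
    unfolding pprt_def by (simp only: diff_sup_eq_inf) simp
  also have "\<dots> = inf b a" by (simp only: add_inf_distrib_left) simp
  finally show ?thesis by (simp add: inf_commute)
qed

lemma closed_atLeast_zero: "closed {x::'a::banach_lattice. 0 \<le> x}"
proof -
  have "l \<ge> 0" if "\<And>n. f n \<ge> 0" "f \<longlonglongrightarrow> l" for f and l :: 'a
  proof -
    have "(\<lambda>n. \<bar>f n\<bar>) \<longlonglongrightarrow> \<bar>l\<bar>" by (rule tendsto_abs_lattice) fact
    moreover have "(\<lambda>n. \<bar>f n\<bar>) = f" using that by auto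
    ultimately have "\<bar>l\<bar> = l" using that LIMSEQ_unique by metis
    then show ?thesis using abs_ge_zero[of l] by simp
  qed
  then show ?thesis by (auto simp: closed_sequential_limits)
qed

lemma lattice_tendsto_le:
  fixes f g :: "nat \<Rightarrow> 'a::banach_lattice"
  assumes "f \<longlonglongrightarrow> l" "g \<longlonglongrightarrow> m" "eventually (\<lambda>n. f n \<le> g n) sequentially"
  shows "l \<le> m"
proof -
  have "m - l \<in> {x. 0 \<le> x}"
    by (rule Lim_in_closed_set[OF closed_atLeast_zero _ _ tendsto_diff[OF assms(2,1)]])
       (use assms(3) in auto)
  then show ?thesis by simp
qed

lemma closed_order_interval: "closed {z::'a::banach_lattice. \<bar>z\<bar> \<le> u}"
  unfolding closed_sequential_limits
  using lattice_tendsto_le[OF tendsto_abs_lattice tendsto_const] by fastforce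

lemma archimedean_banach_lattice:
  fixes w y :: "'a::banach_lattice"
  assumes "\<And>k::nat. real k *\<^sub>R w \<le> y"
  shows "w \<le> 0"
proof -
  have "(\<lambda>k. inverse (real (Suc k)) *\<^sub>R y) \<longlonglongrightarrow> 0 *\<^sub>R y"
    by (intro tendsto_scaleR LIMSEQ_inverse_real_of_nat tendsto_const)
  moreover have "w \<le> inverse (real (Suc k)) *\<^sub>R y" for k
  proof -
    have "inverse (real (Suc k)) *\<^sub>R (real (Suc k) *\<^sub>R w) \<le> inverse (real (Suc k)) *\<^sub>R y"
      using assms[of "Suc k"] by (intro scaleR_left_mono) auto
    then show ?thesis by simp
  qed
  ultimately show ?thesis
    using lattice_tendsto_le[OF tendsto_const[of w]] by simp
qed

section \<open>Order continuous norms and band projections\<close>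

lemma order_continuous_normD:
  assumes "order_continuous_norm le" "D \<noteq> {}"
    and "\<And>x y. x \<in> D \<Longrightarrow> y \<in> D \<Longrightarrow> \<exists>z\<in>D. le z x \<and> le z y"
    and "\<And>x. x \<in> D \<Longrightarrow> le 0 x"
    and "\<And>b. (\<And>x. x \<in> D \<Longrightarrow> le b x) \<Longrightarrow> le b 0"
    and "0 < e"
  obtains x where "x \<in> D" "\<And>y. y \<in> D \<Longrightarrow> le y x \<Longrightarrow> norm y < e"
proof -
  have "\<forall>x\<in>D. \<forall>y\<in>D. \<exists>z\<in>D. le z x \<and> le z y" "\<forall>x\<in>D. le 0 x"
    "\<forall>b. (\<forall>x\<in>D. le b x) \<longrightarrow> le b 0"
    using assms(3-5) by simp_all
  then have "\<exists>x\<in>D. \<forall>y\<in>D. le y x \<longrightarrow> norm y < e"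
    using assms(1)[unfolded order_continuous_norm_def, rule_format, of D e] assms(2,6) by simp
  then show ?thesis using that by blast
qed

text \<open>In an order continuous Banach lattice the norm limit of an order bounded increasing
  sequence exists: the differences between its upper bounds and its terms are directed
  downwards to 0, because the lattice is Archimedean.\<close>
lemma order_continuous_norm_incseq_convergent:
  fixes x :: "nat \<Rightarrow> 'a::banach_lattice"
  assumes oc: "order_continuous_norm ((\<le>) :: 'a \<Rightarrow> 'a \<Rightarrow> bool)"
    and inc: "incseq x" and bd: "\<And>n. x n \<le> u"
  obtains l where "x \<longlonglongrightarrow> l" "\<And>n. x n \<le> l" "\<And>b. (\<And>n. x n \<le> b) \<Longrightarrow> l \<le> b"
proof -
  let ?D = "{b - x k |b k. \<forall>n. x n \<le> b}"
  have ne: "?D \<noteq> {}" using bd by blast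
  have dir: "\<exists>z\<in>?D. z \<le> p \<and> z \<le> q" if pq: "p \<in> ?D" "q \<in> ?D" for p q
  proof -
    obtain b k b' k' where p: "p = b - x k" "\<forall>n. x n \<le> b" and q: "q = b' - x k'" "\<forall>n. x n \<le> b'"
      using pq by blast
    have "inf b b' - x (max k k') \<in> ?D" using p q by auto
    moreover have "inf b b' - x (max k k') \<le> p" "inf b b' - x (max k k') \<le> q"
      unfolding p q using inc by (auto intro!: diff_mono simp: incseq_def)
    ultimately show ?thesis by blast
  qed
  have "w \<le> 0" if w: "\<And>p. p \<in> ?D \<Longrightarrow> w \<le> p" for w
  proof -
    have ub: "\<forall>n. x n \<le> u - real k *\<^sub>R w" for k
    proof (induction k)
      case (Suc k)
      have "w \<le> (u - real k *\<^sub>R w) - x n" for n using w Suc by blast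
      then show ?case by (simp add: algebra_simps)
    qed (simp add: bd)
    have "real k *\<^sub>R w \<le> u - x 0" for k
      using ub[of k] by (simp add: algebra_simps)
    then show ?thesis by (rule archimedean_banach_lattice)
  qed
  note inf0 = this
  have "Cauchy x"
  proof (rule CauchyI)
    fix e :: real assume "0 < e"
    then have e2: "0 < e / 2" by simp
    obtain p where p: "p \<in> ?D" and sm: "\<And>q. q \<in> ?D \<Longrightarrow> q \<le> p \<Longrightarrow> norm q < e / 2"
      by (rule order_continuous_normD[OF oc ne dir _ inf0 e2]) auto
    from p obtain b k where b: "\<forall>n. x n \<le> b" and p_eq: "p = b - x k" by blast
    have near: "norm (b - x m) < e / 2" if "m \<ge> k" for m
      by (rule sm) (use b inc that p_eq in \<open>auto simp: incseq_def\<close>)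
    show "\<exists>M. \<forall>m\<ge>M. \<forall>n\<ge>M. norm (x m - x n) < e"
    proof (intro exI allI impI)
      fix m n assume "k \<le> m" "k \<le> n"
      then show "norm (x m - x n) < e"
        using norm_triangle_ineq4[of "b - x n" "b - x m"] near[of m] near[of n] by simp
    qed
  qed
  then obtain l where l: "x \<longlonglongrightarrow> l" using Cauchy_convergent convergent_def by blast
  show ?thesis
  proof
    show "x \<longlonglongrightarrow> l" by fact
    show "x n \<le> l" for n
      by (rule lattice_tendsto_le[OF tendsto_const l])
         (use inc in \<open>auto simp: incseq_def eventually_sequentially\<close>)
    show "l \<le> b" if "\<And>n. x n \<le> b" for b
      by (rule lattice_tendsto_le[OF l tendsto_const]) (simp add: that)
  qed
qed

lemma blinfun_mono:
  assumes "dual_le 0 \<psi>" "x \<le> y"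
  shows "blinfun_apply \<psi> x \<le> blinfun_apply \<psi> y"
proof -
  have "0 \<le> blinfun_apply \<psi> (y - x)"
    using assms by (simp add: dual_le_def)
  then show ?thesis by (simp add: blinfun.diff_right)
qed

lemma blinfun_nonneg: "dual_le 0 \<psi> \<Longrightarrow> 0 \<le> x \<Longrightarrow> 0 \<le> blinfun_apply \<psi> x"
  by (simp add: dual_le_def)

lemma tendsto_blinfun_apply:
  assumes "(f \<longlongrightarrow> l) F"
  shows "((\<lambda>x. blinfun_apply \<psi> (f x)) \<longlongrightarrow> blinfun_apply \<psi> l) F"
  by (rule bounded_linear.tendsto[OF blinfun.bounded_linear_right assms])

text \<open>The projection onto the band generated by \<open>w \<ge> 0\<close>: for \<open>x \<ge> 0\<close> it is the norm limit of
  the elements \<open>inf x (m w)\<close>, where \<open>m\<close> runs through the natural numbers.\<close>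
lemma ex_band_projection:
  fixes w :: "'a::banach_lattice"
  assumes oc: "order_continuous_norm ((\<le>) :: 'a \<Rightarrow> 'a \<Rightarrow> bool)" and w: "0 \<le> w"
  shows "\<exists>P :: 'a \<Rightarrow>\<^sub>L 'a. \<forall>x\<ge>0. (\<lambda>m. inf x (real m *\<^sub>R w)) \<longlonglongrightarrow> blinfun_apply P x"
proof -
  define p where "p x = lim (\<lambda>m. inf x (real m *\<^sub>R w))" for x
  have inc: "incseq (\<lambda>m. inf x (real m *\<^sub>R w))" for x
    unfolding incseq_def by (intro allI impI inf_mono scaleR_right_mono w) auto
  have lim: "(\<lambda>m. inf x (real m *\<^sub>R w)) \<longlonglongrightarrow> p x"
    and ge: "\<And>m. inf x (real m *\<^sub>R w) \<le> p x"
    and least: "\<And>b. (\<And>m. inf x (real m *\<^sub>R w) \<le> b) \<Longrightarrow> p x \<le> b" for x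
  proof -
    obtain l where l: "(\<lambda>m. inf x (real m *\<^sub>R w)) \<longlonglongrightarrow> l" "\<And>m. inf x (real m *\<^sub>R w) \<le> l"
      "\<And>b. (\<And>m. inf x (real m *\<^sub>R w) \<le> b) \<Longrightarrow> l \<le> b"
      using order_continuous_norm_incseq_convergent[OF oc inc, of x x] by auto
    have "p x = l" unfolding p_def using l(1) by (rule limI)
    with l show "(\<lambda>m. inf x (real m *\<^sub>R w)) \<longlonglongrightarrow> p x"
      "\<And>m. inf x (real m *\<^sub>R w) \<le> p x"
      "\<And>b. (\<And>m. inf x (real m *\<^sub>R w) \<le> b) \<Longrightarrow> p x \<le> b" by blast+
  qed
  have p_pos: "0 \<le> p x" if "0 \<le> x" for x
    using ge[of x 0] that by (simp add: inf_absorb2)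
  have p_le: "p x \<le> x" for x by (rule least) simp
  have p_add: "p (x + y) = p x + p y" if "0 \<le> x" "0 \<le> y" for x y
  proof (rule order.antisym)
    show "p (x + y) \<le> p x + p y"
    proof (rule least)
      fix m
      have "inf (x + y) (real m *\<^sub>R w) \<le> inf x (real m *\<^sub>R w) + inf y (real m *\<^sub>R w)"
        using that w by (intro inf_add_le scaleR_nonneg_nonneg) auto
      also have "\<dots> \<le> p x + p y" by (intro add_mono ge)
      finally show "inf (x + y) (real m *\<^sub>R w) \<le> p x + p y" .
    qed
    have "inf x (real m *\<^sub>R w) + inf y (real m *\<^sub>R w) \<le> p (x + y)" for m
    proof -
      have "inf x (real m *\<^sub>R w) + inf y (real m *\<^sub>R w) \<le> real m *\<^sub>R w + real m *\<^sub>R w"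
        by (intro add_mono) auto
      then have "inf x (real m *\<^sub>R w) + inf y (real m *\<^sub>R w) \<le> real (m + m) *\<^sub>R w"
        by (simp only: of_nat_add scaleR_add_left)
      moreover have "inf x (real m *\<^sub>R w) + inf y (real m *\<^sub>R w) \<le> x + y"
        by (intro add_mono) auto
      ultimately have "inf x (real m *\<^sub>R w) + inf y (real m *\<^sub>R w) \<le> inf (x + y) (real (m + m) *\<^sub>R w)"
        by (simp del: of_nat_add)
      then show ?thesis using ge[of "x + y" "m + m"] by (rule order_trans)
    qed
    then show "p x + p y \<le> p (x + y)"
      by (intro lattice_tendsto_le[OF tendsto_add[OF lim lim] tendsto_const]) auto
  qed
  have p_scale_le: "p (a *\<^sub>R x) \<le> a *\<^sub>R p x" if "0 < a" for a x
  proof (rule least)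
    fix m
    obtain n where n: "real m / a \<le> real n" using real_arch_simple by blast
    have "inf (a *\<^sub>R x) (real m *\<^sub>R w) \<le> inf (a *\<^sub>R x) (a *\<^sub>R (real n *\<^sub>R w))"
      using n that scaleR_right_mono[OF _ w, of "real m" "a * real n"]
      by (intro inf_mono) (auto simp: field_simps)
    also have "\<dots> \<le> a *\<^sub>R p x"
      using that ge[of x n] scaleR_left_mono[of "inf x (real n *\<^sub>R w)" "p x" a]
      by (simp only: scaleR_inf_distrib less_imp_le)
    finally show "inf (a *\<^sub>R x) (real m *\<^sub>R w) \<le> a *\<^sub>R p x" .
  qed
  have p_scale: "p (a *\<^sub>R x) = a *\<^sub>R p x" if a: "0 < a" for a x
  proof (rule order.antisym[OF p_scale_le[OF a]])
    have "p ((1 / a) *\<^sub>R (a *\<^sub>R x)) \<le> (1 / a) *\<^sub>R p (a *\<^sub>R x)"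
      using a by (intro p_scale_le) auto
    then have "a *\<^sub>R p ((1 / a) *\<^sub>R (a *\<^sub>R x)) \<le> a *\<^sub>R ((1 / a) *\<^sub>R p (a *\<^sub>R x))"
      using a by (intro scaleR_left_mono) auto
    then show "a *\<^sub>R p x \<le> p (a *\<^sub>R x)" using a by simp
  qed
  define P where "P x = p (pprt x) - p (pprt (- x))" for x
  have P_diff: "P (a - b) = p a - p b" if "0 \<le> a" "0 \<le> b" for a b
  proof -
    have "a + pprt (- (a - b)) = b + pprt (a - b)"
      using pprt_minus_pprt[of "a - b"] by (simp add: algebra_simps)
    then have "p a + p (pprt (- (a - b))) = p b + p (pprt (a - b))"
      using that p_add by (metis zero_le_pprt)
    then show ?thesis unfolding P_def by (metis add_diff_eq diff_add_eq diff_eq_eq add.commute)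
  qed
  have "bounded_linear P"
  proof (rule bounded_linear_intro)
    fix x y
    have "P (x + y) = P ((pprt x + pprt y) - (pprt (- x) + pprt (- y)))"
      using pprt_minus_pprt[of x] pprt_minus_pprt[of y] by (simp add: add_diff_add)
    also have "\<dots> = p (pprt x + pprt y) - p (pprt (- x) + pprt (- y))"
      by (intro P_diff add_nonneg_nonneg zero_le_pprt)
    also have "\<dots> = P x + P y" by (simp add: p_add P_def)
    finally show "P (x + y) = P x + P y" .
  next
    have pos: "P (a *\<^sub>R x) = a *\<^sub>R P x" if "0 < a" for a x
    proof -
      have "P (a *\<^sub>R x) = P (a *\<^sub>R pprt x - a *\<^sub>R pprt (- x))"
        using pprt_minus_pprt[of x] by (metis scaleR_diff_right)
      also have "\<dots> = a *\<^sub>R P x"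
        using that P_diff[of "a *\<^sub>R pprt x" "a *\<^sub>R pprt (- x)"]
        by (simp add: p_scale P_def[of x] scaleR_diff_right scaleR_nonneg_nonneg)
      finally show ?thesis .
    qed
    have minus: "P (- x) = - P x" for x by (simp add: P_def)
    fix r :: real and x
    consider "r > 0" | "r = 0" | "- r > 0" by linarith
    then show "P (r *\<^sub>R x) = r *\<^sub>R P x"
    proof cases
      case 1
      then show ?thesis by (rule pos)
    next
      case 2
      then show ?thesis by (simp add: P_def)
    next
      case 3
      then show ?thesis using pos[of "- r" x] minus[of "r *\<^sub>R x"] by simp
    qed
  next
    fix x
    have "\<bar>P x\<bar> \<le> \<bar>p (pprt x)\<bar> + \<bar>p (pprt (- x))\<bar>"
      unfolding P_def by (rule abs_triangle_ineq4)
    also have "\<dots> \<le> pprt x + pprt (- x)"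
      by (intro add_mono) (simp_all add: p_pos p_le)
    also have "\<dots> = \<bar>x\<bar>" by (rule pprt_plus_pprt)
    finally show "norm (P x) \<le> norm x * 1" by (simp add: norm_lattice)
  qed
  moreover have "(\<lambda>m. inf x (real m *\<^sub>R w)) \<longlonglongrightarrow> P x" if "0 \<le> x" for x
  proof -
    have "p 0 = 0" by (intro order.antisym p_pos p_le order_refl)
    then show ?thesis using that lim[of x] P_diff[of x 0] by simp
  qed
  ultimately show ?thesis
    by (intro exI[of _ "Blinfun P"]) (simp add: bounded_linear_Blinfun_apply)
qed

text \<open>The band projection is chosen by its values on the positive cone, which determine it. For
  \<open>w\<close> not positive, or without order continuity, the value may be unspecified.\<close>
definition band_proj :: "'a::banach_lattice \<Rightarrow> 'a \<Rightarrow>\<^sub>L 'a" where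
  "band_proj w = (SOME P. \<forall>x\<ge>0. (\<lambda>m. inf x (real m *\<^sub>R w)) \<longlonglongrightarrow> blinfun_apply P x)"

context
  fixes w :: "'a::banach_lattice"
  assumes oc: "order_continuous_norm ((\<le>) :: 'a \<Rightarrow> 'a \<Rightarrow> bool)" and w: "0 \<le> w"
begin

lemma band_proj_tendsto:
  "0 \<le> x \<Longrightarrow> (\<lambda>m. inf x (real m *\<^sub>R w)) \<longlonglongrightarrow> blinfun_apply (band_proj w) x"
  using someI_ex[OF ex_band_projection[OF oc w]] unfolding band_proj_def by blast

lemma band_proj_nonneg: "0 \<le> x \<Longrightarrow> 0 \<le> blinfun_apply (band_proj w) x"
  by (rule lattice_tendsto_le[OF tendsto_const band_proj_tendsto])
     (simp_all add: w scaleR_nonneg_nonneg)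

lemma band_proj_self: "blinfun_apply (band_proj w) w = w"
proof (rule LIMSEQ_unique[OF band_proj_tendsto[OF w]])
  have "inf w (real m *\<^sub>R w) = w" if "m \<ge> 1" for m
    using scaleR_right_mono[OF _ w, of 1 "real m"] that by (simp add: inf_absorb1)
  then show "(\<lambda>m. inf w (real m *\<^sub>R w)) \<longlonglongrightarrow> w"
    by (intro tendsto_eventually) (auto simp: eventually_sequentially)
qed

lemma band_proj_disjoint:
  assumes "0 \<le> x" "inf x w = 0"
  shows "blinfun_apply (band_proj w) x = 0"
proof (rule LIMSEQ_unique[OF band_proj_tendsto[OF assms(1)]])
  have "inf x (real m *\<^sub>R w) = 0" for m
    using disjoint_scaleR[of w x "real m"] assms w by (simp add: inf_commute)
  then show "(\<lambda>m. inf x (real m *\<^sub>R w)) \<longlonglongrightarrow> 0" by simp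
qed

end

lemma sum_disjoint_le:
  fixes a :: "nat \<Rightarrow> 'a::banach_lattice"
  assumes "\<And>i. 0 \<le> a i" "\<And>i j. i \<noteq> j \<Longrightarrow> inf (a i) (a j) = 0" "\<And>i. a i \<le> x" "0 \<le> x"
  shows "(\<Sum>i<n. a i) \<le> x"
proof (induction n)
  case (Suc n)
  have "inf (\<Sum>i<k. a i) (a n) = 0" if "k \<le> n" for k
    using that
  proof (induction k)
    case (Suc k)
    have "inf (\<Sum>i<Suc k. a i) (a n) \<le> inf (\<Sum>i<k. a i) (a n) + inf (a k) (a n)"
      using assms(1) by (simp add: inf_add_le sum_nonneg)
    then have "inf (\<Sum>i<Suc k. a i) (a n) \<le> 0"
      using Suc assms(2)[of k n] by simp
    moreover have "0 \<le> (\<Sum>i<Suc k. a i)" using assms(1) by (rule sum_nonneg)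
    ultimately show ?case using assms(1)[of n] by (intro order.antisym le_infI)
  qed (simp add: assms inf_absorb1)
  then have "(\<Sum>i<n. a i) + a n = sup (\<Sum>i<n. a i) (a n)"
    using add_eq_inf_sup[of "\<Sum>i<n. a i" "a n"] by simp
  then show ?case using Suc assms(3)[of n] by simp
qed (simp add: assms)

section \<open>Bounded disjoint sequences and order continuity of the dual norm\<close>

text \<open>If the dual norm is order continuous, then a positive functional cannot be bounded away from
  0 on a bounded disjoint sequence \<open>w\<close>. With \<open>P i\<close> the projection onto the band of \<open>w i\<close>, the
  functionals \<open>\<psi> \<circ> P i\<close> have partial sums below \<open>\<psi>\<close>, so the tails of their series decrease to 0
  and hence tend to 0 in norm, whereas the \<open>k\<close>-th tail is at least \<open>\<psi> (w k)\<close> at \<open>w k\<close>.\<close>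
lemma dual_order_continuous_disjoint_small:
  fixes w :: "nat \<Rightarrow> 'a::banach_lattice"
  assumes oc: "order_continuous_norm ((\<le>) :: 'a \<Rightarrow> 'a \<Rightarrow> bool)"
    and ocd: "order_continuous_norm (dual_le :: ('a \<Rightarrow>\<^sub>L real) \<Rightarrow> ('a \<Rightarrow>\<^sub>L real) \<Rightarrow> bool)"
    and \<psi>: "dual_le 0 \<psi>"
    and w: "\<And>k. 0 \<le> w k" and disj: "\<And>i j. i \<noteq> j \<Longrightarrow> inf (w i) (w j) = 0"
    and bd: "\<And>k. norm (w k) \<le> M" and \<delta>: "0 < \<delta>"
  shows "\<exists>k. blinfun_apply \<psi> (w k) < \<delta>"
proof (rule ccontr)
  assume "\<not> ?thesis"
  then have ge: "\<delta> \<le> blinfun_apply \<psi> (w k)" for k by (meson not_le)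
  define \<psi>' where "\<psi>' i = \<psi> o\<^sub>L band_proj (w i)" for i
  have \<psi>'_pos: "0 \<le> blinfun_apply (\<psi>' i) x" if "0 \<le> x" for i x
    unfolding \<psi>'_def using that by (simp add: blinfun_nonneg[OF \<psi>] band_proj_nonneg[OF oc w])
  define s where "s n = (\<Sum>i<n. \<psi>' i)" for n
  have s_apply: "blinfun_apply (s n) x = (\<Sum>i<n. blinfun_apply (\<psi>' i) x)" for n x
    by (simp add: s_def blinfun.sum_left)
  have s_le: "blinfun_apply (s n) x \<le> blinfun_apply \<psi> x" if x: "0 \<le> x" for n x
  proof -
    have "(\<Sum>i<n. inf x (real m *\<^sub>R w i)) \<le> x" for m
    proof (rule sum_disjoint_le)
      fix i j :: nat assume "i \<noteq> j"
      have 1: "inf (real m *\<^sub>R w i) (w j) = 0"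
        using w disj[OF \<open>i \<noteq> j\<close>] by (intro disjoint_scaleR) auto
      have 2: "inf (real m *\<^sub>R w j) (real m *\<^sub>R w i) = 0"
        using 1 w by (intro disjoint_scaleR) (auto simp: inf_commute scaleR_nonneg_nonneg)
      have "inf (inf x (real m *\<^sub>R w i)) (inf x (real m *\<^sub>R w j)) \<le> inf (real m *\<^sub>R w j) (real m *\<^sub>R w i)"
        by (simp add: le_infI1 le_infI2)
      then show "inf (inf x (real m *\<^sub>R w i)) (inf x (real m *\<^sub>R w j)) = 0"
        unfolding 2 using x w by (intro order.antisym) (auto simp: scaleR_nonneg_nonneg)
    qed (use x w in \<open>auto simp: scaleR_nonneg_nonneg\<close>)
    moreover have "(\<lambda>m. \<Sum>i<n. inf x (real m *\<^sub>R w i)) \<longlonglongrightarrow> (\<Sum>i<n. blinfun_apply (band_proj (w i)) x)"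
      by (intro tendsto_sum band_proj_tendsto oc w x)
    ultimately have "(\<Sum>i<n. blinfun_apply (band_proj (w i)) x) \<le> x"
      by (intro lattice_tendsto_le[OF _ tendsto_const]) auto
    then have "blinfun_apply \<psi> (\<Sum>i<n. blinfun_apply (band_proj (w i)) x) \<le> blinfun_apply \<psi> x"
      by (rule blinfun_mono[OF \<psi>])
    then show ?thesis by (simp add: s_apply \<psi>'_def blinfun.sum_right)
  qed
  have s_mono: "blinfun_apply (s m) x \<le> blinfun_apply (s n) x" if "m \<le> n" "0 \<le> x" for m n x
    unfolding s_apply using that \<psi>'_pos by (intro sum_mono2) auto
  have conv_pos: "convergent (\<lambda>n. blinfun_apply (s n) x)" if "0 \<le> x" for x
  proof -
    have "incseq (\<lambda>n. blinfun_apply (s n) x)" using s_mono that by (auto simp: incseq_def)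
    then show ?thesis
      using s_le[OF that] by (metis incseq_convergent convergentI)
  qed
  have conv: "convergent (\<lambda>n. blinfun_apply (s n) x)" for x
  proof -
    have "convergent (\<lambda>n. blinfun_apply (s n) (pprt x) - blinfun_apply (s n) (pprt (- x)))"
      by (intro convergent_diff conv_pos) auto
    then show ?thesis by (simp only: blinfun.diff_right[symmetric] pprt_minus_pprt)
  qed
  define S where "S x = lim (\<lambda>n. blinfun_apply (s n) x)" for x
  have S: "(\<lambda>n. blinfun_apply (s n) x) \<longlonglongrightarrow> S x" for x
    unfolding S_def using conv convergent_LIMSEQ_iff by blast
  have "bounded_linear S"
  proof (rule bounded_linear_intro)
    show "S (x + y) = S x + S y" for x y
      by (rule LIMSEQ_unique[OF S]) (simp add: blinfun.add_right tendsto_add S)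
    show "S (r *\<^sub>R x) = r *\<^sub>R S x" for r x
      by (rule LIMSEQ_unique[OF S]) (simp add: blinfun.scaleR_right tendsto_mult_left S)
    fix x
    have "\<bar>blinfun_apply (s n) x\<bar> \<le> norm x * norm \<psi>" for n
    proof -
      have "\<bar>blinfun_apply (s n) x\<bar> = \<bar>blinfun_apply (s n) (pprt x) - blinfun_apply (s n) (pprt (- x))\<bar>"
        by (simp only: blinfun.diff_right[symmetric] pprt_minus_pprt)
      also have "\<dots> \<le> blinfun_apply (s n) (pprt x) + blinfun_apply (s n) (pprt (- x))"
        using s_mono[of 0 n "pprt x"] s_mono[of 0 n "pprt (- x)"] by (simp add: s_def)
      also have "\<dots> = blinfun_apply (s n) \<bar>x\<bar>"
        by (simp only: blinfun.add_right[symmetric] pprt_plus_pprt)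
      also have "\<dots> \<le> blinfun_apply \<psi> \<bar>x\<bar>" by (rule s_le) simp
      also have "\<dots> \<le> norm \<psi> * norm x" using norm_blinfun[of \<psi> "\<bar>x\<bar>"] by simp
      finally show ?thesis by (simp add: mult.commute)
    qed
    then show "norm (S x) \<le> norm x * norm \<psi>"
      using LIMSEQ_le_const2[OF tendsto_rabs[OF S[of x]]] by auto
  qed
  then have S_apply: "blinfun_apply (Blinfun S) = S" by (rule bounded_linear_Blinfun_apply)
  have le_S: "blinfun_apply (s n) x \<le> S x" if "0 \<le> x" for n x
    using LIMSEQ_le_const[OF S[of x], of "blinfun_apply (s n) x"] s_mono that by auto
  let ?t = "\<lambda>k. Blinfun S - s k"
  have t_mono: "dual_le (?t n) (?t m)" if "m \<le> n" for m n
    unfolding dual_le_def using s_mono[OF that] by (simp add: blinfun.diff_left)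
  have "0 \<le> M" using bd[of 0] norm_ge_zero order_trans by blast
  obtain \<tau> where \<tau>: "\<tau> \<in> range ?t" "\<And>y. y \<in> range ?t \<Longrightarrow> dual_le y \<tau> \<Longrightarrow> norm y < \<delta> / (M + 1)"
  proof (rule order_continuous_normD[OF ocd, of "range ?t" "\<delta> / (M + 1)"])
    show "range ?t \<noteq> {}" by simp
    show "\<exists>z\<in>range ?t. dual_le z x \<and> dual_le z y" if xy: "x \<in> range ?t" "y \<in> range ?t" for x y
    proof -
      obtain m n where "x = ?t m" "y = ?t n" using xy by blast
      then show ?thesis
        using t_mono[of m "max m n"] t_mono[of n "max m n"] by auto
    qed
    show "dual_le 0 x" if "x \<in> range ?t" for x
      using that le_S by (auto simp: dual_le_def blinfun.diff_left S_apply)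
    show "dual_le b 0" if b: "\<And>x. x \<in> range ?t \<Longrightarrow> dual_le b x" for b
      unfolding dual_le_def
    proof (intro allI impI)
      fix x :: 'a assume "0 \<le> x"
      then have "blinfun_apply b x \<le> S x - blinfun_apply (s n) x" for n
        using b[of "?t n"] by (simp add: dual_le_def blinfun.diff_left S_apply)
      then show "blinfun_apply b x \<le> blinfun_apply 0 x"
        using LIMSEQ_le_const[OF tendsto_diff[OF tendsto_const S[of x]], of "blinfun_apply b x" "S x"]
        by auto
    qed
    show "0 < \<delta> / (M + 1)" using \<delta> \<open>0 \<le> M\<close> by simp
  qed blast
  then obtain k where k: "\<tau> = ?t k" by blast
  have nt: "norm (?t k) < \<delta> / (M + 1)" using \<tau>(2)[of \<tau>] \<tau>(1) k by (simp add: dual_le_def)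
  have "\<delta> \<le> blinfun_apply (\<psi>' k) (w k)"
    using ge[of k] by (simp add: \<psi>'_def band_proj_self[OF oc w])
  also have "\<dots> = blinfun_apply (s (Suc k)) (w k) - blinfun_apply (s k) (w k)"
    by (simp add: s_apply)
  also have "\<dots> \<le> blinfun_apply (?t k) (w k)"
    using le_S[OF w] by (simp add: blinfun.diff_left S_apply)
  also have "\<dots> \<le> norm (?t k) * norm (w k)"
    using norm_blinfun[of "?t k" "w k"] by simp
  also have "\<dots> \<le> \<delta> / (M + 1) * M"
    using nt bd[of k] \<delta> \<open>0 \<le> M\<close> by (intro mult_mono) auto
  also have "\<dots> < \<delta>" using \<delta> \<open>0 \<le> M\<close> by (simp add: field_simps)
  finally show False by simp
qed

section \<open>A strictly positive functional\<close>

text \<open>The functional is the sum of \<open>(1/2) ^ n *\<^sub>R f n\<close> over an enumeration \<open>f\<close> of the norming set.\<close>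
lemma positively_norming_ex_strictly_positive:
  fixes B :: "('a::banach_lattice \<Rightarrow>\<^sub>L real) set"
  assumes "countable B" "positively_norming B"
  obtains \<phi> :: "'a \<Rightarrow>\<^sub>L real" where "dual_le 0 \<phi>"
    "\<And>x. 0 \<le> x \<Longrightarrow> blinfun_apply \<phi> x = 0 \<Longrightarrow> x = 0"
proof -
  define f where "f = from_nat_into B"
  have ne: "B \<noteq> {}" and B: "B \<subseteq> cball 0 1 \<inter> {\<phi>. dual_le 0 \<phi>}"
    using assms(2) by (auto simp: positively_norming_def)
  obtain c where c: "\<And>x. norm x \<le> c * (SUP \<phi>\<in>B. blinfun_apply \<phi> \<bar>x\<bar>)"
    using assms(2) by (auto simp: positively_norming_def)
  have f: "f n \<in> B" for n unfolding f_def using ne by (rule from_nat_into)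
  have f1: "norm (f n) \<le> 1" and f_pos: "dual_le 0 (f n)" for n using f[of n] B by auto
  let ?g = "\<lambda>n. (1/2) ^ n *\<^sub>R f n"
  have sm: "summable ?g"
  proof (rule summable_comparison_test'[of "\<lambda>n. (1/2) ^ n" 0])
    show "norm (?g n) \<le> (1/2) ^ n" for n
      using mult_left_le[OF f1[of n], of "(1/2)^n"] by simp
  qed simp
  have ap: "(\<lambda>n. (1/2) ^ n * blinfun_apply (f n) x) sums blinfun_apply (suminf ?g) x" for x
    using bounded_linear.sums[OF blinfun.bounded_linear_left summable_sums[OF sm], of x]
    by (simp add: blinfun.scaleR_left)
  have nn: "0 \<le> (1/2) ^ n * blinfun_apply (f n) x" if "0 \<le> x" for n x
    using blinfun_nonneg[OF f_pos that] by simp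
  show ?thesis
  proof (rule that[of "suminf ?g"])
    show "dual_le 0 (suminf ?g)"
      unfolding dual_le_def using nn ap sums_le[OF _ sums_zero ap] by simp
    fix x :: 'a assume x: "0 \<le> x" "blinfun_apply (suminf ?g) x = 0"
    have "(\<Sum>n. (1/2) ^ n * blinfun_apply (f n) x) = 0"
      using ap[of x] x(2) by (simp add: sums_iff)
    then have "(1/2) ^ n * blinfun_apply (f n) x = 0" for n
      using suminf_eq_zero_iff[OF sums_summable[OF ap[of x]] nn[OF x(1)]] by simp
    then have z: "blinfun_apply (f n) x = 0" for n by simp
    have "blinfun_apply \<phi> \<bar>x\<bar> = 0" if "\<phi> \<in> B" for \<phi>
      using z x(1) that from_nat_into_surj[OF assms(1)] unfolding f_def by (metis abs_of_nonneg)
    then have "(SUP \<phi>\<in>B. blinfun_apply \<phi> \<bar>x\<bar>) = 0"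
      using ne by simp
    then have "norm x \<le> 0" using c[of x] by simp
    then show "x = 0" by simp
  qed
qed

text \<open>On an order interval the norm is controlled by any strictly positive functional. For a
  sequence violating this, the tail sums truncated at \<open>u\<close> would decrease to an element at which
  the functional vanishes, while their norms stay bounded away from 0.\<close>
lemma strictly_positive_norm_small:
  fixes u :: "'a::banach_lattice"
  assumes oc: "order_continuous_norm ((\<le>) :: 'a \<Rightarrow> 'a \<Rightarrow> bool)"
    and \<phi>: "dual_le 0 \<phi>" and strict: "\<And>x. 0 \<le> x \<Longrightarrow> blinfun_apply \<phi> x = 0 \<Longrightarrow> x = 0"
    and u: "0 \<le> u" and e: "0 < e"
  shows "\<exists>d>0. \<forall>x. 0 \<le> x \<and> x \<le> u \<and> blinfun_apply \<phi> x < d \<longrightarrow> norm x < e"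
proof (rule ccontr)
  assume "\<not> ?thesis"
  then have "\<exists>x. 0 \<le> x \<and> x \<le> u \<and> blinfun_apply \<phi> x < (1/2) ^ n \<and> e \<le> norm x" for n
    by (metis not_le zero_less_power half_gt_zero zero_less_one)
  then obtain x where x: "\<And>n. 0 \<le> x n" "\<And>n. x n \<le> u" "\<And>n. blinfun_apply \<phi> (x n) < (1/2) ^ n"
    "\<And>n. e \<le> norm (x n)"
    by metis
  \<comment> \<open>The elements \<open>v j\<close> dominate all \<open>x n\<close> with \<open>n \<ge> j\<close> and decrease to 0.\<close>
  define y where "y j n = inf u (\<Sum>k\<in>{j..<n}. x k)" for j n
  have y_mono: "y j n \<le> y i m" if "i \<le> j" "n \<le> m" for i j n m
    unfolding y_def using that x(1) by (intro inf_mono order_refl sum_mono2) auto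
  have "\<exists>l. y j \<longlonglongrightarrow> l \<and> (\<forall>n. y j n \<le> l) \<and> (\<forall>b. (\<forall>n. y j n \<le> b) \<longrightarrow> l \<le> b)" for j
  proof -
    have "incseq (y j)" unfolding incseq_def using y_mono[of j j] by simp
    moreover have "y j n \<le> u" for n by (simp add: y_def)
    ultimately show ?thesis
      using order_continuous_norm_incseq_convergent[OF oc, of "y j" u] by metis
  qed
  then obtain v where v: "\<And>j. y j \<longlonglongrightarrow> v j" "\<And>j n. y j n \<le> v j"
    "\<And>j b. (\<And>n. y j n \<le> b) \<Longrightarrow> v j \<le> b"
    by metis
  have v_pos: "0 \<le> v j" for j using v(2)[of j j] u by (simp add: y_def inf_absorb2)
  have xv: "x j \<le> v j" for j
    using v(2)[of j "Suc j"] x(2)[of j] by (simp add: y_def inf_absorb2)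
  have v_dec: "v j \<le> v i" if "i \<le> j" for i j
    by (rule v(3)) (rule order_trans[OF y_mono[OF that order_refl] v(2)])
  have \<phi>v: "blinfun_apply \<phi> (v j) \<le> 2 * (1/2) ^ j" for j
  proof (rule LIMSEQ_le_const2[OF tendsto_blinfun_apply[OF v(1)]])
    have "blinfun_apply \<phi> (y j n) \<le> 2 * (1/2) ^ j" for n
    proof -
      have "blinfun_apply \<phi> (y j n) \<le> (\<Sum>k\<in>{j..<n}. blinfun_apply \<phi> (x k))"
        using blinfun_mono[OF \<phi>, of "y j n" "\<Sum>k\<in>{j..<n}. x k"] by (simp add: y_def blinfun.sum_right)
      also have "\<dots> \<le> (\<Sum>k\<in>{j..<n}. (1/2) ^ k)"
        using x(3) by (intro sum_mono) (auto intro: less_imp_le)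
      also have "\<dots> \<le> 2 * (1/2) ^ j"
      proof (cases "j \<le> n")
        case True
        then have "(\<Sum>k\<in>{j..<n}. (1/2::real) ^ k) = 2 * (1/2) ^ j - 2 * (1/2) ^ n"
          by (induction n rule: nat_induct_at_least) auto
        then show ?thesis by simp
      qed simp
      finally show ?thesis .
    qed
    then show "\<exists>N. \<forall>n\<ge>N. blinfun_apply \<phi> (y j n) \<le> 2 * (1/2) ^ j" by blast
  qed
  have "incseq (\<lambda>j. u - v j)" using v_dec by (auto simp: incseq_def diff_left_mono)
  then obtain l where l: "(\<lambda>j. u - v j) \<longlonglongrightarrow> l" "\<And>b. (\<And>j. u - v j \<le> b) \<Longrightarrow> l \<le> b"
    using order_continuous_norm_incseq_convergent[OF oc, of "\<lambda>j. u - v j" u] v_pos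
    by (metis diff_le_eq le_add_same_cancel1)
  have vl: "v \<longlonglongrightarrow> u - l" using tendsto_diff[OF tendsto_const l(1), of u] by simp
  have ul: "0 \<le> u - l" using l(2)[of u] v_pos by simp
  have "(\<lambda>j. 2 * (1/2::real) ^ j) \<longlonglongrightarrow> 2 * 0"
    by (intro tendsto_mult_left LIMSEQ_power_zero) auto
  then have "blinfun_apply \<phi> (u - l) \<le> 0"
    using LIMSEQ_le[OF tendsto_blinfun_apply[OF vl, of \<phi>]] \<phi>v by (simp only: mult_zero_right) blast
  then have "u - l = 0" using strict[OF ul] blinfun_nonneg[OF \<phi> ul] by simp
  then have "(\<lambda>j. norm (v j)) \<longlonglongrightarrow> 0" using vl tendsto_norm_zero by fastforce
  moreover have "e \<le> norm (v j)" for j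
    using x(4)[of j] norm_mono_nonneg[OF x(1) xv, of j] by simp
  ultimately have "e \<le> 0" using LIMSEQ_le_const by blast
  with e show False by simp
qed

section \<open>Compactness of order intervals for chains of closed convex sets\<close>

text \<open>In a function space, \<open>\<bar>w\<bar> \<le> u\<close> implies that at each point the values of \<open>w\<close> and of some
  multiple \<open>(i/N - 1) u\<close> with \<open>i \<le> 2 N\<close> differ by at most \<open>u/N\<close>. Without representing the lattice
  by functions: a common lower bound of the moduli of these differences is at most \<open>u/N\<close>.\<close>
lemma le_scaled_of_le_abs_grid:
  fixes w u t :: "'a::banach_lattice"
  assumes w: "\<bar>w\<bar> \<le> u" and N: "0 < N"
    and t: "\<And>i. i \<le> 2 * N \<Longrightarrow> t \<le> \<bar>w - (real i / real N - 1) *\<^sub>R u\<bar>"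
  shows "t \<le> (1 / real N) *\<^sub>R u"
proof -
  let ?h = "(1 / real N) *\<^sub>R u"
  have "0 \<le> u" using w by (rule order_trans[OF abs_ge_zero])
  then have h: "0 \<le> ?h" by (intro scaleR_nonneg_nonneg) auto
  \<comment> \<open>As long as \<open>w\<close> is above the \<open>i\<close>-th multiple, the bound by \<open>?h\<close> may fail; at \<open>i = 2 N\<close> the
    second argument of \<open>sup\<close> is \<open>w - u \<le> 0\<close>.\<close>
  have step: "t \<le> sup ?h (w - (real i / real N - 1) *\<^sub>R u)" if "i \<le> 2 * N" for i
    using that
  proof (induction i)
    case 0
    have "- w \<le> u" using w by (rule abs_le_D2)
    then have "0 \<le> w + u" by (metis add.commute diff_ge_0_iff_ge diff_minus_eq_add)
    then show ?case using t[of 0] by (simp add: le_supI2)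
  next
    case (Suc i)
    let ?p = "w - (real (Suc i) / real N - 1) *\<^sub>R u"
    have "(real i / real N - 1) *\<^sub>R u = (real (Suc i) / real N - 1) *\<^sub>R u - ?h"
      using N by (simp flip: scaleR_diff_left add: field_simps)
    then have pe: "w - (real i / real N - 1) *\<^sub>R u = ?p + ?h"
      by (simp only: algebra_simps)
    have "sup ?h (?p + ?h) = ?h + pprt ?p"
      unfolding pprt_def by (simp add: add_sup_distrib_left sup_commute add.commute)
    then have 1: "t \<le> ?h + pprt ?p" using Suc pe by simp
    have "inf (?h + pprt ?p) (- ?p) \<le> inf (?h + pprt ?p) (pprt (- ?p))"
      unfolding pprt_def by (intro inf_mono) auto
    also have "\<dots> \<le> inf ?h (pprt (- ?p)) + inf (pprt ?p) (pprt (- ?p))"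
      by (rule inf_add_le[OF h]) auto
    also have "\<dots> = inf ?h (pprt (- ?p))" by (simp only: pprt_disjoint add_0_right)
    also have "\<dots> \<le> ?h" by (rule inf_le1)
    finally have 2: "inf (?h + pprt ?p) (- ?p) \<le> ?h" .
    have "t \<le> inf (?h + pprt ?p) \<bar>?p\<bar>"
      using 1 t[OF Suc.prems] by (rule inf_greatest)
    also have "\<dots> = sup (inf (?h + pprt ?p) ?p) (inf (?h + pprt ?p) (- ?p))"
      by (simp only: abs_lattice lattice_group_inf_sup_distrib)
    also have "\<dots> \<le> sup ?h ?p"
      using 2 by (intro sup_least le_supI1[OF 2] le_supI2 inf_le2)
    finally show ?case .
  qed
  have "w - u \<le> ?h"
    using abs_le_D1[OF w] h by (metis diff_le_0_iff_le order_trans)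
  then show ?thesis using step[of "2 * N"] N by (simp add: sup_absorb1)
qed

lemma abs_diff_scaled_le_sum_grid:
  fixes w u d :: "'a::banach_lattice"
  assumes w: "\<bar>w\<bar> \<le> u" and N: "0 < N"
  shows "\<bar>d\<bar> - (1 / real N) *\<^sub>R u \<le> (\<Sum>i\<le>2 * N. pprt (\<bar>d\<bar> - \<bar>w - (real i / real N - 1) *\<^sub>R u\<bar>))"
    (is "_ \<le> (\<Sum>i\<le>_. ?g i)")
proof -
  have "\<bar>d\<bar> - (\<Sum>i\<le>2 * N. ?g i) \<le> \<bar>w - (real i / real N - 1) *\<^sub>R u\<bar>" if "i \<le> 2 * N" for i
  proof -
    have "\<bar>d\<bar> - \<bar>w - (real i / real N - 1) *\<^sub>R u\<bar> \<le> ?g i" by (simp add: pprt_def)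
    also have "\<dots> \<le> (\<Sum>i\<le>2 * N. ?g i)" using that sum_mono2[of "{..2 * N}" "{i}" ?g] by simp
    finally show ?thesis by (simp add: algebra_simps)
  qed
  then have "\<bar>d\<bar> - (\<Sum>i\<le>2 * N. ?g i) \<le> (1 / real N) *\<^sub>R u"
    by (rule le_scaled_of_le_abs_grid[OF w N])
  then show ?thesis by (simp add: algebra_simps)
qed

text \<open>The mean \<open>\<phi>\<close>-distance, up to a factor, of \<open>z\<close> from the multiples \<open>c u\<close>, where \<open>c\<close> runs
  through a grid of mesh \<open>1 / (N + 1)\<close> in \<open>[-1, 1]\<close>. Using \<open>N + 1\<close> avoids the mesh \<open>1 / 0\<close>.\<close>
definition grid_energy :: "('a::banach_lattice \<Rightarrow>\<^sub>L real) \<Rightarrow> 'a \<Rightarrow> nat \<Rightarrow> 'a \<Rightarrow> real" where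
  "grid_energy \<phi> u N z =
    (\<Sum>i\<le>2 * Suc N. blinfun_apply \<phi> \<bar>z - (real i / real (Suc N) - 1) *\<^sub>R u\<bar>)"

text \<open>A weighted sum of the grid energies. For strictly positive \<open>\<phi>\<close> it is a strictly convex
  function on \<open>[-u, u]\<close>, and takes the place of the square of the norm of a Hilbert space, for
  which a multiplication would be needed. The weights make the series converge uniformly there.\<close>
definition energy :: "('a::banach_lattice \<Rightarrow>\<^sub>L real) \<Rightarrow> 'a \<Rightarrow> 'a \<Rightarrow> real" where
  "energy \<phi> u z = (\<Sum>N. (1/2) ^ N / real (2 * Suc N + 1) * grid_energy \<phi> u N z)"

text \<open>For closed subsets of a normed space this property is convexity; only midpoints are ever used.\<close>
definition midpoint_closed :: "'a::real_vector set \<Rightarrow> bool" where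
  "midpoint_closed C \<longleftrightarrow> (\<forall>x\<in>C. \<forall>y\<in>C. (1/2) *\<^sub>R (x + y) \<in> C)"

lemma abs_midpoint_le:
  fixes x y u :: "'a::banach_lattice"
  assumes "\<bar>x\<bar> \<le> u" "\<bar>y\<bar> \<le> u"
  shows "\<bar>(1/2) *\<^sub>R (x + y)\<bar> \<le> u"
proof (rule abs_leI)
  have *: "(1/2) *\<^sub>R (a + b) \<le> u" if "a \<le> u" "b \<le> u" for a b
  proof -
    have "(1/2) *\<^sub>R (a + b) \<le> (1/2) *\<^sub>R (u + u)"
      using that by (intro scaleR_left_mono add_mono) auto
    then show ?thesis by (simp flip: scaleR_2)
  qed
  show "(1/2) *\<^sub>R (x + y) \<le> u" by (intro * abs_le_D1[OF assms(1)] abs_le_D1[OF assms(2)])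
  have "(1/2) *\<^sub>R (- x + - y) \<le> u" by (intro * abs_le_D2[OF assms(1)] abs_le_D2[OF assms(2)])
  then show "- ((1/2) *\<^sub>R (x + y)) \<le> u" by (simp flip: scaleR_minus_right)
qed

text \<open>A Banach lattice with order continuous norm and a strictly positive functional.\<close>
locale strictly_positive_functional =
  fixes \<phi> :: "'a::banach_lattice \<Rightarrow>\<^sub>L real"
  assumes oc: "order_continuous_norm ((\<le>) :: 'a \<Rightarrow> 'a \<Rightarrow> bool)"
    and pos: "dual_le 0 \<phi>"
    and strict: "\<And>x. 0 \<le> x \<Longrightarrow> blinfun_apply \<phi> x = 0 \<Longrightarrow> x = 0"
begin

lemma grid_energy_bounds:
  assumes "\<bar>z\<bar> \<le> u"
  shows "0 \<le> grid_energy \<phi> u N z"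
    and "grid_energy \<phi> u N z \<le> real (2 * Suc N + 1) * (2 * blinfun_apply \<phi> u)"
proof -
  have u: "0 \<le> u" using assms by (rule order_trans[OF abs_ge_zero])
  show "0 \<le> grid_energy \<phi> u N z"
    unfolding grid_energy_def by (intro sum_nonneg blinfun_nonneg[OF pos]) simp
  have "blinfun_apply \<phi> \<bar>z - (real i / real (Suc N) - 1) *\<^sub>R u\<bar> \<le> 2 * blinfun_apply \<phi> u"
    if "i \<le> 2 * Suc N" for i
  proof -
    let ?c = "real i / real (Suc N) - 1"
    have "real i \<le> 2 * real (Suc N)" using that by (metis of_nat_le_iff of_nat_mult of_nat_numeral)
    then have c: "?c \<le> 1" "- ?c \<le> 1" by (simp_all add: field_simps)
    have "\<bar>?c *\<^sub>R u\<bar> \<le> u"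
      using scaleR_right_mono[OF c(1) u] scaleR_right_mono[OF c(2) u]
      by (intro abs_leI) (simp_all only: scaleR_minus_left scaleR_one)
    then have "\<bar>z - ?c *\<^sub>R u\<bar> \<le> u + u"
      using abs_triangle_ineq4[of z "?c *\<^sub>R u"] assms by (meson add_mono order_trans)
    then show ?thesis using blinfun_mono[OF pos, of _ "u + u"] by (metis blinfun.add_right mult_2)
  qed
  then have "grid_energy \<phi> u N z \<le> real (card {..2 * Suc N}) * (2 * blinfun_apply \<phi> u)"
    unfolding grid_energy_def by (intro sum_bounded_above) simp
  then show "grid_energy \<phi> u N z \<le> real (2 * Suc N + 1) * (2 * blinfun_apply \<phi> u)"
    by simp
qed

lemma energy_term_le:
  assumes "\<bar>z\<bar> \<le> u"
  shows "(1/2) ^ N / real (2 * Suc N + 1) * grid_energy \<phi> u N z \<le> (1/2) ^ N * (2 * blinfun_apply \<phi> u)"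
proof -
  have "(1/2) ^ N / real (2 * Suc N + 1) * grid_energy \<phi> u N z
      \<le> (1/2) ^ N / real (2 * Suc N + 1) * (real (2 * Suc N + 1) * (2 * blinfun_apply \<phi> u))"
    by (intro mult_left_mono grid_energy_bounds assms) auto
  also have "\<dots> = (1/2) ^ N * (2 * blinfun_apply \<phi> u)" by simp
  finally show ?thesis .
qed

lemma energy_summable:
  assumes "\<bar>z\<bar> \<le> u"
  shows "summable (\<lambda>N. (1/2) ^ N / real (2 * Suc N + 1) * grid_energy \<phi> u N z)"
proof (rule summable_comparison_test'[of "\<lambda>N. (1/2) ^ N * (2 * blinfun_apply \<phi> u)" 0])
  show "summable (\<lambda>N. (1/2::real) ^ N * (2 * blinfun_apply \<phi> u))"
    by (intro summable_mult2 summable_geometric) simp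
  show "norm ((1/2) ^ N / real (2 * Suc N + 1) * grid_energy \<phi> u N z)
      \<le> (1/2) ^ N * (2 * blinfun_apply \<phi> u)" for N
    using energy_term_le[OF assms, of N] grid_energy_bounds(1)[OF assms, of N] by simp
qed

lemma energy_nonneg: "\<bar>z\<bar> \<le> u \<Longrightarrow> 0 \<le> energy \<phi> u z"
  unfolding energy_def by (intro suminf_nonneg energy_summable mult_nonneg_nonneg grid_energy_bounds) auto

text \<open>Uniform convexity of the energy on \<open>[-u, u]\<close>, measured by \<open>\<phi>\<close>: for large \<open>N\<close> the left-hand
  side is positive unless \<open>\<phi> \<bar>d\<bar>\<close> is small.\<close>
lemma energy_gap:
  assumes p: "\<bar>w + d\<bar> \<le> u" and m: "\<bar>w - d\<bar> \<le> u"
  shows "(1/2) ^ N / real (2 * Suc N + 1) * (2 * (blinfun_apply \<phi> \<bar>d\<bar> - blinfun_apply \<phi> u / real (Suc N)))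
    \<le> energy \<phi> u (w + d) + energy \<phi> u (w - d) - 2 * energy \<phi> u w"
proof -
  have w: "\<bar>w\<bar> \<le> u" using abs_midpoint_le[OF p m] by (simp flip: scaleR_2)
  define a where "a N = (1/2) ^ N / real (2 * Suc N + 1)" for N
  have a: "0 \<le> a N" for N by (simp add: a_def)
  define G where "G N = grid_energy \<phi> u N (w + d) + grid_energy \<phi> u N (w - d) - 2 * grid_energy \<phi> u N w" for N
  define q where "q N i = w - (real i / real (Suc N) - 1) *\<^sub>R u" for N i
  have G_ge: "2 * (\<Sum>i\<le>2 * Suc N. blinfun_apply \<phi> (pprt (\<bar>d\<bar> - \<bar>q N i\<bar>))) \<le> G N" for N
  proof -
    have "2 * (\<Sum>i\<le>2 * Suc N. blinfun_apply \<phi> (pprt (\<bar>d\<bar> - \<bar>q N i\<bar>)))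
      \<le> (\<Sum>i\<le>2 * Suc N. blinfun_apply \<phi> \<bar>q N i + d\<bar> + blinfun_apply \<phi> \<bar>q N i - d\<bar> - 2 * blinfun_apply \<phi> \<bar>q N i\<bar>)"
      unfolding sum_distrib_left
    proof (rule sum_mono)
      fix i
      show "2 * blinfun_apply \<phi> (pprt (\<bar>d\<bar> - \<bar>q N i\<bar>))
        \<le> blinfun_apply \<phi> \<bar>q N i + d\<bar> + blinfun_apply \<phi> \<bar>q N i - d\<bar> - 2 * blinfun_apply \<phi> \<bar>q N i\<bar>"
        using blinfun_mono[OF pos abs_parallelogram_ge[of d "q N i"]]
        by (simp add: blinfun.add_right blinfun.diff_right blinfun.scaleR_right)
    qed
    also have "\<dots> = G N"
      unfolding G_def grid_energy_def q_def
      by (simp add: sum.distrib sum_subtractf sum_distrib_left algebra_simps)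
    finally show ?thesis .
  qed
  have G_nonneg: "0 \<le> G N" for N
    by (rule order_trans[OF _ G_ge]) (simp add: sum_nonneg blinfun_nonneg[OF pos])
  have G_sum: "(\<lambda>N. a N * G N) sums (energy \<phi> u (w + d) + energy \<phi> u (w - d) - 2 * energy \<phi> u w)"
  proof -
    have s: "(\<lambda>N. a N * grid_energy \<phi> u N z) sums energy \<phi> u z" if "\<bar>z\<bar> \<le> u" for z
      unfolding energy_def a_def using energy_summable[OF that] by (rule summable_sums)
    show ?thesis
      using sums_diff[OF sums_add[OF s[OF p] s[OF m]] sums_mult[OF s[OF w], of 2]]
      by (simp add: G_def algebra_simps)
  qed
  have "\<bar>d\<bar> - (1 / real (Suc N)) *\<^sub>R u \<le> (\<Sum>i\<le>2 * Suc N. pprt (\<bar>d\<bar> - \<bar>q N i\<bar>))"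
    unfolding q_def by (rule abs_diff_scaled_le_sum_grid[OF w]) simp
  from blinfun_mono[OF pos this]
  have "blinfun_apply \<phi> \<bar>d\<bar> - blinfun_apply \<phi> u / real (Suc N)
      \<le> (\<Sum>i\<le>2 * Suc N. blinfun_apply \<phi> (pprt (\<bar>d\<bar> - \<bar>q N i\<bar>)))"
    by (simp only: blinfun.diff_right blinfun.scaleR_right blinfun.sum_right) simp
  then have "a N * (2 * (blinfun_apply \<phi> \<bar>d\<bar> - blinfun_apply \<phi> u / real (Suc N))) \<le> a N * G N"
    by (intro mult_left_mono[OF order_trans[OF mult_left_mono G_ge]] a) auto
  also have "\<dots> = (\<Sum>M\<in>{N}. a M * G M)" by simp
  also have "\<dots> \<le> (\<Sum>M. a M * G M)"
    by (rule sum_le_suminf) (use G_sum a G_nonneg in \<open>auto simp: sums_iff\<close>)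
  also have "\<dots> = energy \<phi> u (w + d) + energy \<phi> u (w - d) - 2 * energy \<phi> u w"
    using G_sum by (simp add: sums_iff)
  finally show ?thesis by (simp add: a_def)
qed

lemma energy_bounded_above: "\<bar>z\<bar> \<le> u \<Longrightarrow> energy \<phi> u z \<le> 4 * blinfun_apply \<phi> u"
proof -
  assume z: "\<bar>z\<bar> \<le> u"
  have s: "(\<lambda>N. (1/2) ^ N * (2 * blinfun_apply \<phi> u)) sums (2 * (2 * blinfun_apply \<phi> u))"
    using sums_mult2[OF geometric_sums[of "1/2::real"], of "2 * blinfun_apply \<phi> u"] by simp
  then show ?thesis
    using suminf_le[OF energy_term_le[OF z] energy_summable[OF z] sums_summable[OF s]] s
    by (simp add: energy_def sums_iff)
qed

text \<open>Two points of \<open>[-u, u]\<close> are close in norm if their mean energy hardly exceeds the energy of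
  their midpoint.\<close>
lemma energy_near_minimal_close:
  assumes \<eta>: "0 < \<eta>"
  shows "\<exists>\<epsilon>>0. \<forall>x y. \<bar>x\<bar> \<le> u \<and> \<bar>y\<bar> \<le> u \<and>
    energy \<phi> u x + energy \<phi> u y - 2 * energy \<phi> u ((1/2) *\<^sub>R (x + y)) \<le> \<epsilon> \<longrightarrow> norm (x - y) < \<eta>"
proof (cases "0 \<le> u")
  case True
  obtain d where d: "0 < d"
    and small: "\<And>x. 0 \<le> x \<Longrightarrow> x \<le> u \<Longrightarrow> blinfun_apply \<phi> x < d \<Longrightarrow> norm x < \<eta> / 2"
    using strictly_positive_norm_small[OF oc pos strict True half_gt_zero[OF \<eta>]] by blast
  obtain N where N: "blinfun_apply \<phi> u / real (Suc N) < d / 2"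
  proof -
    have "(\<lambda>n. blinfun_apply \<phi> u * inverse (real (Suc n))) \<longlonglongrightarrow> blinfun_apply \<phi> u * 0"
      by (intro tendsto_mult_left LIMSEQ_inverse_real_of_nat)
    then have "eventually (\<lambda>n. blinfun_apply \<phi> u * inverse (real (Suc n)) < d / 2) sequentially"
      using d by (intro order_tendstoD(2)) auto
    then have "\<exists>n. blinfun_apply \<phi> u * inverse (real (Suc n)) < d / 2"
      by (rule eventually_happens'[OF sequentially_bot])
    then show ?thesis using that by (auto simp only: divide_inverse)
  qed
  let ?a = "(1/2) ^ N / real (2 * Suc N + 1)"
  have a: "0 < ?a" by simp
  show ?thesis
  proof (intro exI[of _ "?a * (d / 2)"] conjI allI impI)
    show "0 < ?a * (d / 2)" using a d by simp
    fix x y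
    assume *: "\<bar>x\<bar> \<le> u \<and> \<bar>y\<bar> \<le> u \<and>
      energy \<phi> u x + energy \<phi> u y - 2 * energy \<phi> u ((1/2) *\<^sub>R (x + y)) \<le> ?a * (d / 2)"
    let ?w = "(1/2) *\<^sub>R (x + y)" and ?d = "(1/2) *\<^sub>R (x - y)"
    have wd: "?w + ?d = x" "?w - ?d = y"
      by (simp_all add: scaleR_add_right scaleR_diff_right flip: scaleR_add_left)
    have "?a * (2 * (blinfun_apply \<phi> \<bar>?d\<bar> - blinfun_apply \<phi> u / real (Suc N))) \<le> ?a * (d / 2)"
      using energy_gap[of ?w ?d u N] * unfolding wd by linarith
    then have "2 * (blinfun_apply \<phi> \<bar>?d\<bar> - blinfun_apply \<phi> u / real (Suc N)) \<le> d / 2"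
      using a by (simp only: mult_le_cancel_left_pos)
    then have "blinfun_apply \<phi> \<bar>?d\<bar> < d" using N d by argo
    moreover have "\<bar>?d\<bar> \<le> u" using abs_midpoint_le[of x u "- y"] * by simp
    ultimately have "norm \<bar>?d\<bar> < \<eta> / 2" by (intro small) auto
    then show "norm (x - y) < \<eta>" by simp
  qed
next
  case False
  then have "\<not> \<bar>x\<bar> \<le> u" for x using order_trans[OF abs_ge_zero] by blast
  then show ?thesis by (intro exI[of _ 1]) auto
qed

text \<open>This replaces the weak compactness of order intervals, which holds in order continuous Banach
  lattices. Near minimisers of the energy over small enough members of the chain are close to
  each other, because the midpoint of two of them lies in the larger member; hence they converge,
  and the limit lies in every member.\<close>
theorem chain_closed_midpoint_closed_Inter_nonempty:
  fixes \<C> :: "'a set set"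
  assumes ne: "\<C> \<noteq> {}" and chain: "\<And>C D. C \<in> \<C> \<Longrightarrow> D \<in> \<C> \<Longrightarrow> C \<subseteq> D \<or> D \<subseteq> C"
    and C_ne: "\<And>C. C \<in> \<C> \<Longrightarrow> C \<noteq> {}" and C_closed: "\<And>C. C \<in> \<C> \<Longrightarrow> closed C"
    and C_mid: "\<And>C. C \<in> \<C> \<Longrightarrow> midpoint_closed C"
    and C_le: "\<And>C z. C \<in> \<C> \<Longrightarrow> z \<in> C \<Longrightarrow> \<bar>z\<bar> \<le> u"
  shows "\<Inter>\<C> \<noteq> {}"
proof -
  let ?J = "energy \<phi> u"
  define I where "I C = Inf (?J ` C)" for C
  define m where "m = Sup (I ` \<C>)"
  have bb: "bdd_below (?J ` C)" if "C \<in> \<C>" for C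
    using energy_nonneg[OF C_le[OF that]] by (intro bdd_belowI[of _ 0]) auto
  have I_le: "I C \<le> ?J z" if "C \<in> \<C>" "z \<in> C" for C z
    unfolding I_def using that bb by (intro cInf_lower) auto
  have "I C \<le> 4 * blinfun_apply \<phi> u" if "C \<in> \<C>" for C
    using that C_ne I_le energy_bounded_above[OF C_le] by (metis ex_in_conv order_trans)
  then have ba: "bdd_above (I ` \<C>)" by (intro bdd_aboveI[of _ "4 * blinfun_apply \<phi> u"]) auto
  have I_le_m: "I C \<le> m" if "C \<in> \<C>" for C
    unfolding m_def using that ba by (intro cSup_upper) auto
  define good where "good \<epsilon> C z \<longleftrightarrow> C \<in> \<C> \<and> z \<in> C \<and> ?J z < m + \<epsilon> \<and> m - \<epsilon> < I C" for \<epsilon> C z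
  have ex_good: "\<exists>C z. good \<epsilon> C z \<and> C \<subseteq> D" if \<epsilon>: "0 < \<epsilon>" and D: "D \<in> \<C>" for \<epsilon> D
  proof -
    obtain C0 where C0: "C0 \<in> \<C>" "m - \<epsilon> < I C0"
      using less_cSup_iff[of "I ` \<C>" "m - \<epsilon>"] ne ba \<epsilon> unfolding m_def by auto
    obtain C where C: "C \<in> \<C>" "C \<subseteq> D" "C \<subseteq> C0" using chain[OF D C0(1)] D C0(1) by blast
    have "I C0 \<le> I C" unfolding I_def
      using C C_ne bb C0(1) by (intro cInf_superset_mono) auto
    then have "m - \<epsilon> < I C" using C0 by simp
    moreover have "I C < m + \<epsilon>" using I_le_m[OF C(1)] \<epsilon> by simp
    then obtain z where "z \<in> C" "?J z < m + \<epsilon>"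
      unfolding I_def using cInf_less_iff[of "?J ` C" "m + \<epsilon>"] C(1) C_ne bb by auto
    ultimately show ?thesis using C unfolding good_def by blast
  qed
  have close: "\<exists>\<epsilon>>0. \<forall>C z D y. good \<epsilon> C z \<and> good \<epsilon> D y \<longrightarrow> norm (z - y) < \<eta>" if \<eta>: "0 < \<eta>" for \<eta>
  proof -
    obtain \<epsilon> where \<epsilon>: "0 < \<epsilon>" and cl: "\<And>x y. \<bar>x\<bar> \<le> u \<Longrightarrow> \<bar>y\<bar> \<le> u \<Longrightarrow>
      ?J x + ?J y - 2 * ?J ((1/2) *\<^sub>R (x + y)) \<le> \<epsilon> \<Longrightarrow> norm (x - y) < \<eta>"
      using energy_near_minimal_close[OF \<eta>] by blast
    have "norm (z - y) < \<eta>" if g: "good (\<epsilon> / 4) C z" "good (\<epsilon> / 4) D y" for C z D y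
    proof -
      have CD: "C \<in> \<C>" "D \<in> \<C>" "z \<in> C" "y \<in> D" using g by (auto simp: good_def)
      obtain E where E: "E \<in> \<C>" "z \<in> E" "y \<in> E" "m - \<epsilon> / 4 < I E"
        using chain[OF CD(1,2)] CD g unfolding good_def by blast
      have "(1/2) *\<^sub>R (z + y) \<in> E" using C_mid[OF E(1)] E by (simp add: midpoint_closed_def)
      then have "m - \<epsilon> / 4 < ?J ((1/2) *\<^sub>R (z + y))"
        using I_le[OF E(1)] E(4) by (meson less_le_trans)
      moreover have "?J z < m + \<epsilon> / 4" "?J y < m + \<epsilon> / 4" using g by (auto simp: good_def)
      ultimately show ?thesis using CD by (intro cl C_le) auto
    qed
    then show ?thesis using \<epsilon> by (intro exI[of _ "\<epsilon> / 4"]) auto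
  qed
  have good_mono: "good \<epsilon> C z \<Longrightarrow> \<epsilon> \<le> \<epsilon>' \<Longrightarrow> good \<epsilon>' C z" for \<epsilon> \<epsilon>' C z
    by (auto simp: good_def)
  have "\<forall>n D. \<exists>z. D \<in> \<C> \<longrightarrow> (\<exists>C. good (inverse (real (Suc n))) C z \<and> C \<subseteq> D)"
    using ex_good by (metis inverse_positive_iff_positive of_nat_0_less_iff zero_less_Suc)
  then obtain zD where zD: "\<And>n D. D \<in> \<C> \<Longrightarrow> \<exists>C. good (inverse (real (Suc n))) C (zD n D) \<and> C \<subseteq> D"
    by metis
  have near: "\<exists>M. \<forall>n\<ge>M. \<forall>k\<ge>M. norm (zD n D - zD k D') < \<eta>"
    if D: "D \<in> \<C>" "D' \<in> \<C>" and \<eta>: "0 < \<eta>" for D D' \<eta>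
  proof -
    obtain \<epsilon> where \<epsilon>: "0 < \<epsilon>" "\<And>C z D y. good \<epsilon> C z \<Longrightarrow> good \<epsilon> D y \<Longrightarrow> norm (z - y) < \<eta>"
      using close[OF \<eta>] by blast
    obtain M where M: "inverse (real (Suc M)) < \<epsilon>" using reals_Archimedean[OF \<epsilon>(1)] by blast
    have "\<exists>C. good \<epsilon> C (zD n D)" if "M \<le> n" "D \<in> \<C>" for n D
    proof -
      have "inverse (real (Suc n)) \<le> inverse (real (Suc M))"
        using that by (intro le_imp_inverse_le) auto
      then show ?thesis using zD[OF that(2), of n] M good_mono
        by (meson less_imp_le order_trans)
    qed
    then show ?thesis using \<epsilon>(2) D by meson
  qed
  obtain D0 where D0: "D0 \<in> \<C>" using ne by blast
  have "Cauchy (\<lambda>n. zD n D0)" by (rule CauchyI) (use near[OF D0 D0] in blast)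
  then obtain z where z: "(\<lambda>n. zD n D0) \<longlonglongrightarrow> z" using Cauchy_convergent convergent_def by blast
  have "z \<in> D" if D: "D \<in> \<C>" for D
  proof -
    have "(\<lambda>n. zD n D - zD n D0) \<longlonglongrightarrow> 0"
      by (rule LIMSEQ_I) (use near[OF D D0] in fastforce)
    from tendsto_add[OF this z] have "(\<lambda>n. zD n D) \<longlonglongrightarrow> z" by simp
    moreover have "zD n D \<in> D" for n using zD[OF D, of n] by (auto simp: good_def)
    ultimately show ?thesis using closed_sequentially[OF C_closed[OF D], of "\<lambda>n. zD n D" z] by simp
  qed
  then show ?thesis by blast
qed

end

section \<open>Separable sets and separable order intervals\<close>

text \<open>The countable set need not be contained in \<open>A\<close>, so that the property passes to subsets in
  any topological space. In metric spaces it is equivalent to separability of the subspace \<open>A\<close>.\<close>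
definition separable_set :: "'a::topological_space set \<Rightarrow> bool" where
  "separable_set A \<longleftrightarrow> (\<exists>D. countable D \<and> A \<subseteq> closure D)"

lemma separable_setI: "countable D \<Longrightarrow> A \<subseteq> closure D \<Longrightarrow> separable_set A"
  by (auto simp: separable_set_def)

lemma separable_set_subset: "separable_set B \<Longrightarrow> A \<subseteq> B \<Longrightarrow> separable_set A"
  by (auto simp: separable_set_def)

lemma separable_set_subset_closure: "separable_set B \<Longrightarrow> A \<subseteq> closure B \<Longrightarrow> separable_set A"
  unfolding separable_set_def by (meson closed_closure closure_minimal order_trans)

lemma separable_set_UN:
  fixes A :: "nat \<Rightarrow> 'a::topological_space set"
  assumes "\<And>n. separable_set (A n)"
  shows "separable_set (\<Union>n. A n)"
proof -
  obtain D where D: "\<And>n. countable (D n)" "\<And>n. A n \<subseteq> closure (D n)"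
    using assms unfolding separable_set_def by metis
  show ?thesis
  proof (rule separable_setI)
    show "countable (\<Union>n. D n)" using D by simp
    show "(\<Union>n. A n) \<subseteq> closure (\<Union>n. D n)"
      using D(2) closure_mono[of "D _" "\<Union>n. D n"] by (blast intro: subsetD)
  qed
qed

lemma separable_set_image2:
  fixes g :: "'a::topological_space \<times> 'b::topological_space \<Rightarrow> 'c::topological_space"
  assumes "separable_set A" "separable_set B" and g: "continuous_on UNIV g"
  shows "separable_set (g ` (A \<times> B))"
proof -
  obtain D E where D: "countable D" "A \<subseteq> closure D" and E: "countable E" "B \<subseteq> closure E"
    using assms(1,2) by (auto simp: separable_set_def)
  have "g ` closure (D \<times> E) \<subseteq> closure (g ` (D \<times> E))"
    using g by (intro image_closure_subset closed_closure closure_subset)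
      (auto intro: continuous_on_subset)
  moreover have "A \<times> B \<subseteq> closure (D \<times> E)"
    using D(2) E(2) by (auto simp: closure_Times)
  ultimately have "g ` (A \<times> B) \<subseteq> closure (g ` (D \<times> E))"
    by (meson image_mono order_trans)
  then show ?thesis using D(1) E(1) by (intro separable_setI[of "g ` (D \<times> E)"]) auto
qed

lemma separable_order_interval_add:
  fixes a b :: "'a::banach_lattice"
  assumes "separable_set {0..a}" "separable_set {0..b}" and ab: "0 \<le> a" "0 \<le> b"
  shows "separable_set {0..a + b}"
proof (rule separable_set_subset)
  show "separable_set ((\<lambda>(x, y). x + y) ` ({0..a} \<times> {0..b}))"
    by (intro separable_set_image2 assms) (auto simp: split_beta intro!: continuous_intros)
  show "{0..a + b} \<subseteq> (\<lambda>(x, y). x + y) ` ({0..a} \<times> {0..b})"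
  proof
    fix x assume x: "x \<in> {0..a + b}"
    have "x - inf x a = pprt (x - a)" by (metis inf_eq_pprt add_diff_cancel_left' diff_add_cancel)
    moreover have "pprt (x - a) \<le> b"
      unfolding pprt_def using ab x by (intro sup_least) (simp_all add: diff_le_eq add.commute)
    ultimately have "inf x a \<in> {0..a}" "x - inf x a \<in> {0..b}" using x ab
      by (auto simp del: diff_inf_eq_sup)
    then show "x \<in> (\<lambda>(x, y). x + y) ` ({0..a} \<times> {0..b})"
      by (intro image_eqI[of _ _ "(inf x a, x - inf x a)"]) (auto simp del: diff_inf_eq_sup)
  qed
qed

text \<open>The sets obtained from \<open>D\<close> by adding all midpoints \<open>n\<close> times. Their union is the least
  set containing \<open>D\<close> that is closed under midpoints; it is countable if \<open>D\<close> is.\<close>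
primrec midpoint_iterate :: "'a::real_vector set \<Rightarrow> nat \<Rightarrow> 'a set" where
  "midpoint_iterate D 0 = D"
| "midpoint_iterate D (Suc n) = midpoint_iterate D n \<union>
    (\<lambda>(x, y). (1/2) *\<^sub>R (x + y)) ` (midpoint_iterate D n \<times> midpoint_iterate D n)"

lemma countable_midpoint_iterate: "countable D \<Longrightarrow> countable (midpoint_iterate D n)"
  by (induction n) auto

lemma midpoint_iterate_mono: "m \<le> n \<Longrightarrow> midpoint_iterate D m \<subseteq> midpoint_iterate D n"
  by (rule lift_Suc_mono_le[of "midpoint_iterate D"]) auto

lemma midpoint_iterate_subset:
  assumes "D \<subseteq> C" "midpoint_closed C"
  shows "midpoint_iterate D n \<subseteq> C"
  using assms by (induction n) (auto simp: midpoint_closed_def)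

lemma midpoint_closed_UN_iterate: "midpoint_closed (\<Union>n. midpoint_iterate D n)"
  unfolding midpoint_closed_def
proof (intro ballI)
  fix x y assume "x \<in> (\<Union>n. midpoint_iterate D n)" "y \<in> (\<Union>n. midpoint_iterate D n)"
  then obtain m n where "x \<in> midpoint_iterate D m" "y \<in> midpoint_iterate D n" by blast
  then have "x \<in> midpoint_iterate D (max m n)" "y \<in> midpoint_iterate D (max m n)"
    using midpoint_iterate_mono[of m "max m n" D] midpoint_iterate_mono[of n "max m n" D] by auto
  then have "(1/2) *\<^sub>R (x + y) \<in> midpoint_iterate D (Suc (max m n))"
    by (auto intro!: image_eqI[of _ _ "(x, y)"])
  then show "(1/2) *\<^sub>R (x + y) \<in> (\<Union>n. midpoint_iterate D n)" by blast
qed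

lemma midpoint_closed_closure:
  fixes C :: "'a::real_normed_vector set"
  assumes "midpoint_closed C"
  shows "midpoint_closed (closure C)"
  unfolding midpoint_closed_def
proof (intro ballI)
  fix x y assume "x \<in> closure C" "y \<in> closure C"
  then obtain a b where ab: "\<And>n. a n \<in> C" "a \<longlonglongrightarrow> x" "\<And>n. b n \<in> C" "b \<longlonglongrightarrow> y"
    unfolding closure_sequential by blast
  have "(\<lambda>n. (1/2) *\<^sub>R (a n + b n)) \<longlonglongrightarrow> (1/2) *\<^sub>R (x + y)"
    by (intro tendsto_intros ab(2) ab(4))
  moreover have "(1/2) *\<^sub>R (a n + b n) \<in> C" for n
    using assms ab by (simp add: midpoint_closed_def)
  ultimately show "(1/2) *\<^sub>R (x + y) \<in> closure C"
    unfolding closure_sequential by (intro exI[of _ "\<lambda>n. (1/2) *\<^sub>R (a n + b n)"]) simp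
qed

lemma midpoint_closed_Int: "midpoint_closed C \<Longrightarrow> midpoint_closed D \<Longrightarrow> midpoint_closed (C \<inter> D)"
  by (auto simp: midpoint_closed_def)

lemma midpoint_closed_slab:
  "midpoint_closed {y. \<bar>blinfun_apply f y - a\<bar> \<le> (r::real)}"
proof -
  have "\<bar>(p + q) / 2 - a\<bar> \<le> r" if "\<bar>p - a\<bar> \<le> r" "\<bar>q - a\<bar> \<le> r" for p q
    using that by (auto simp: abs_le_iff field_simps)
  then show ?thesis
    by (simp add: midpoint_closed_def blinfun.scaleR_right blinfun.add_right)
qed

lemma midpoint_closed_half_space: "midpoint_closed {y. (r::real) \<le> blinfun_apply f y}"
  by (auto simp: midpoint_closed_def blinfun.scaleR_right blinfun.add_right)

lemma midpoint_closed_INT: "(\<And>i. i \<in> I \<Longrightarrow> midpoint_closed (C i)) \<Longrightarrow> midpoint_closed (\<Inter>i\<in>I. C i)"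
  by (auto simp: midpoint_closed_def)

lemma closed_nonneg_interval: "closed {0..v::'a::banach_lattice}"
proof -
  have "{0..v} = {x. 0 \<le> x} \<inter> {x. \<bar>x\<bar> \<le> v}"
    by (auto intro: abs_leI order_trans[OF _ abs_ge_self])
  then show ?thesis by (simp add: closed_Int closed_atLeast_zero closed_order_interval)
qed

lemma midpoint_closed_nonneg_interval: "midpoint_closed {0..v::'a::banach_lattice}"
  unfolding midpoint_closed_def
proof (intro ballI)
  fix x y assume "x \<in> {0..v}" "y \<in> {0..v}"
  then show "(1/2) *\<^sub>R (x + y) \<in> {0..v}"
    using abs_midpoint_le[of x v y] abs_le_D1[of "(1/2) *\<^sub>R (x + y)" v]
    by (auto intro!: scaleR_nonneg_nonneg)
qed

text \<open>A sequence of functionals induces on any set a second countable topology, which has a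
  countable dense set.\<close>
lemma ex_countable_weakly_dense:
  fixes f :: "nat \<Rightarrow> 'a::real_normed_vector \<Rightarrow>\<^sub>L real" and S :: "'a set"
  obtains D where "countable D" "D \<subseteq> S"
    "\<And>x j r. x \<in> S \<Longrightarrow> 0 < r \<Longrightarrow> \<exists>d\<in>D. \<forall>i\<le>j. \<bar>blinfun_apply (f i) d - blinfun_apply (f i) x\<bar> < r"
proof -
  define T where "T x = (\<lambda>i. blinfun_apply (f i) x)" for x
  obtain \<B> :: "(nat \<Rightarrow> real) set set" where \<B>: "countable \<B>"
    "\<And>U. open U \<Longrightarrow> \<exists>\<U>. \<U> \<subseteq> \<B> \<and> U = \<Union>\<U>"
    by (metis univ_second_countable)
  define pick where "pick U = (SOME x. x \<in> S \<and> T x \<in> U)" for U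
  have pick: "pick U \<in> S \<and> T (pick U) \<in> U" if "x \<in> S" "T x \<in> U" for x U
    unfolding pick_def by (rule someI[of _ x]) (use that in simp)
  define D where "D = pick ` {U \<in> \<B>. \<exists>x\<in>S. T x \<in> U}"
  show ?thesis
  proof (rule that[of D])
    show "countable D" unfolding D_def using \<B>(1) by (simp add: countable_subset[of _ \<B>])
    show "D \<subseteq> S" unfolding D_def using pick by blast
    fix x :: 'a and j :: nat and r :: real
    assume x: "x \<in> S" and r: "0 < r"
    let ?U = "\<Inter>i\<in>{..j}. {y. \<bar>y i - T x i\<bar> < r}"
    have open_U: "open ?U"
      by (intro open_INT ballI open_Collect_less continuous_on_rabs continuous_on_diff
          continuous_on_product_coordinates continuous_on_const) simp
    then obtain \<U> where \<U>: "\<U> \<subseteq> \<B>" "?U = \<Union>\<U>" using \<B>(2)[OF open_U] by (elim exE conjE)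
    have "T x \<in> ?U" using r by simp
    then obtain V where V: "V \<in> \<U>" "T x \<in> V" using \<U>(2) by auto
    have "pick V \<in> D" unfolding D_def using V \<U>(1) x by blast
    moreover have "T (pick V) \<in> ?U" using pick[OF x V(2)] V(1) \<U>(2) by blast
    ultimately show "\<exists>d\<in>D. \<forall>i\<le>j. \<bar>blinfun_apply (f i) d - blinfun_apply (f i) x\<bar> < r"
      by (auto simp: T_def)
  qed
qed

context strictly_positive_functional
begin

text \<open>If countably many functionals separate the points of \<open>[-v, v]\<close>, then \<open>[0, v]\<close> is
  separable: it is the closed convex hull of a countable set that is dense for the topology
  induced by these functionals.\<close>
lemma separating_imp_separable_interval:
  fixes f :: "nat \<Rightarrow> 'a \<Rightarrow>\<^sub>L real"
  assumes sep: "\<And>z. \<bar>z\<bar> \<le> v \<Longrightarrow> (\<And>n. blinfun_apply (f n) z = 0) \<Longrightarrow> z = 0"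
  shows "separable_set {0..v}"
proof -
  obtain D where D: "countable D" "D \<subseteq> {0..v}"
    and dense: "\<And>x j r. x \<in> {0..v} \<Longrightarrow> 0 < r \<Longrightarrow>
      \<exists>d\<in>D. \<forall>i\<le>j. \<bar>blinfun_apply (f i) d - blinfun_apply (f i) x\<bar> < r"
    using ex_countable_weakly_dense[of "{0..v}" f] by blast
  define M where "M = (\<Union>n. midpoint_iterate D n)"
  have M: "countable M" "midpoint_closed M"
    unfolding M_def using D(1) countable_midpoint_iterate midpoint_closed_UN_iterate by auto
  have DM: "D \<subseteq> closure M"
  proof -
    have "D \<subseteq> M" unfolding M_def using midpoint_iterate.simps(1)[of D] by blast
    then show ?thesis using closure_subset by (rule order_trans)
  qed
  have "M \<subseteq> {0..v}"
    unfolding M_def using midpoint_iterate_subset[OF D(2) midpoint_closed_nonneg_interval] by blast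
  then have M_sub: "closure M \<subseteq> {0..v}"
    by (intro closure_minimal closed_nonneg_interval)
  have "x \<in> closure M" if x: "x \<in> {0..v}" for x
  proof -
    define C where "C j = closure M \<inter>
      (\<Inter>i\<in>{..j}. {y. \<bar>blinfun_apply (f i) y - blinfun_apply (f i) x\<bar> \<le> inverse (real (Suc j))})" for j
    have anti: "C k \<subseteq> C j" if "j \<le> k" for j k
    proof -
      have "inverse (real (Suc k)) \<le> inverse (real (Suc j))"
        using that by (intro le_imp_inverse_le) auto
      moreover have "y \<in> C i \<longleftrightarrow> y \<in> closure M \<and>
          (\<forall>n\<le>i. \<bar>blinfun_apply (f n) y - blinfun_apply (f n) x\<bar> \<le> inverse (real (Suc i)))" for y i
        by (auto simp: C_def)
      ultimately show ?thesis using that by (meson order_trans subsetI)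
    qed
    have "\<Inter>(range C) \<noteq> {}"
    proof (rule chain_closed_midpoint_closed_Inter_nonempty[of _ v])
      show "E \<subseteq> F \<or> F \<subseteq> E" if "E \<in> range C" "F \<in> range C" for E F
        using that anti by (metis imageE nat_le_linear)
      show "E \<noteq> {}" if E: "E \<in> range C" for E
      proof -
        obtain j where j: "E = C j" using E by blast
        obtain d where "d \<in> D" "\<forall>i\<le>j. \<bar>blinfun_apply (f i) d - blinfun_apply (f i) x\<bar> < inverse (real (Suc j))"
          using dense[OF x, of "inverse (real (Suc j))" j] by auto
        then have "d \<in> C j" using DM by (auto simp: C_def intro: less_imp_le)
        then show ?thesis using j by blast
      qed
      show "closed E" if "E \<in> range C" for E
        using that unfolding C_def
        by (auto intro!: closed_Int closed_INT closed_Collect_le continuous_intros)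
      show "midpoint_closed E" if "E \<in> range C" for E
        using that unfolding C_def
        by (auto intro!: midpoint_closed_Int midpoint_closed_INT midpoint_closed_slab midpoint_closed_closure M)
      show "\<bar>z\<bar> \<le> v" if "E \<in> range C" "z \<in> E" for E z
        using that M_sub by (auto simp: C_def)
    qed simp
    then obtain y where y: "\<And>j. y \<in> C j" by blast
    have yM: "y \<in> closure M" using y[of 0] by (simp add: C_def)
    have "blinfun_apply (f i) (y - x) = 0" for i
    proof -
      have "\<bar>blinfun_apply (f i) y - blinfun_apply (f i) x\<bar> \<le> inverse (real (Suc j))" if "j \<ge> i" for j
        using y[of j] that by (simp add: C_def)
      then have "\<bar>blinfun_apply (f i) y - blinfun_apply (f i) x\<bar> \<le> 0"
        using LIMSEQ_le_const[OF LIMSEQ_inverse_real_of_nat] by blast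
      then show ?thesis by (simp add: blinfun.diff_right)
    qed
    moreover have "\<bar>y - x\<bar> \<le> v"
    proof (rule abs_leI)
      have xy: "0 \<le> x" "x \<le> v" "0 \<le> y" "y \<le> v" using x yM M_sub by auto
      show "y - x \<le> v" using xy by (metis diff_left_mono diff_zero order_trans)
      show "- (y - x) \<le> v" using xy by (metis diff_left_mono diff_zero minus_diff_eq order_trans)
    qed
    ultimately have "y - x = 0" using sep by blast
    then show ?thesis using yM by simp
  qed
  then show ?thesis using M(1) by (intro separable_setI[of M]) auto
qed

end

section \<open>Elements with no separable order interval below them\<close>

text \<open>A positive element below which only 0 has a separable order interval. In spaces such as \<open>L\<^sub>p\<close>,
  this means that the underlying measure space is nowhere countably generated on the support of
  \<open>u\<close>. The element 0 satisfies this trivially.\<close>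
definition nowhere_separable :: "'a::banach_lattice \<Rightarrow> bool" where
  "nowhere_separable u \<longleftrightarrow> 0 \<le> u \<and> (\<forall>v. 0 \<le> v \<and> v \<le> u \<and> v \<noteq> 0 \<longrightarrow> \<not> separable_set {0..v})"

lemma nowhere_separable_le: "nowhere_separable u \<Longrightarrow> 0 \<le> v \<Longrightarrow> v \<le> u \<Longrightarrow> nowhere_separable v"
  unfolding nowhere_separable_def by (meson order_trans)

context strictly_positive_functional
begin

text \<open>Elements of a disjoint family at which \<open>\<phi>\<close> is at least \<open>1/n\<close> are finite in number, since
  \<open>\<phi>\<close> would otherwise be bounded away from 0 on a bounded disjoint sequence.\<close>
lemma countable_disjoint_bounded:
  fixes V :: "'a set"
  assumes ocd: "order_continuous_norm (dual_le :: ('a \<Rightarrow>\<^sub>L real) \<Rightarrow> ('a \<Rightarrow>\<^sub>L real) \<Rightarrow> bool)"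
    and nonneg: "\<And>v. v \<in> V \<Longrightarrow> 0 \<le> v" and nz: "\<And>v. v \<in> V \<Longrightarrow> v \<noteq> 0"
    and bd: "\<And>v. v \<in> V \<Longrightarrow> norm v \<le> 1"
    and disj: "\<And>v w. v \<in> V \<Longrightarrow> w \<in> V \<Longrightarrow> v \<noteq> w \<Longrightarrow> inf v w = 0"
  shows "countable V"
proof -
  let ?V = "\<lambda>n. {v \<in> V. inverse (real (Suc n)) \<le> blinfun_apply \<phi> v}"
  have fin: "finite (?V n)" for n
  proof (rule ccontr)
    assume "infinite (?V n)"
    then obtain w :: "nat \<Rightarrow> 'a" where w: "inj w" "range w \<subseteq> ?V n"
      using infinite_countable_subset by blast
    have wV: "w k \<in> V" "inverse (real (Suc n)) \<le> blinfun_apply \<phi> (w k)" for k using w(2) by auto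
    have "inf (w i) (w j) = 0" if "i \<noteq> j" for i j
      using disj wV(1) w(1) that by (meson injD)
    then have "\<exists>k. blinfun_apply \<phi> (w k) < inverse (real (Suc n))"
      using wV nonneg bd by (intro dual_order_continuous_disjoint_small[OF oc ocd pos, of w 1]) auto
    then show False using wV(2) by (meson not_le)
  qed
  have "V = (\<Union>n. ?V n)"
  proof -
    have "\<exists>n. inverse (real (Suc n)) \<le> blinfun_apply \<phi> v" if "v \<in> V" for v
    proof -
      have "0 < blinfun_apply \<phi> v"
        using strict[OF nonneg[OF that]] nz[OF that] blinfun_nonneg[OF pos nonneg[OF that]] by fastforce
      then show ?thesis using reals_Archimedean less_imp_le by blast
    qed
    then show ?thesis by auto
  qed
  moreover have "countable (\<Union>n. ?V n)"
    by (rule countable_UN) (simp, rule countable_finite, rule fin)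
  ultimately show ?thesis by simp
qed

text \<open>If every nonzero positive element dominates a nonzero one with separable order interval, then
  a maximal disjoint family of the latter is countable and generates the whole lattice as a band,
  which makes the lattice separable.\<close>
lemma ex_nowhere_separable:
  assumes ocd: "order_continuous_norm (dual_le :: ('a \<Rightarrow>\<^sub>L real) \<Rightarrow> ('a \<Rightarrow>\<^sub>L real) \<Rightarrow> bool)"
    and nonsep: "\<not> separable_set (UNIV :: 'a set)"
  obtains u :: 'a where "nowhere_separable u" "u \<noteq> 0"
proof (rule ccontr)
  assume "\<not> thesis"
  then have H: "\<exists>v. 0 \<le> v \<and> v \<le> u \<and> v \<noteq> 0 \<and> separable_set {0..v}" if "0 \<le> u" "u \<noteq> 0" for u :: 'a
    using that \<open>\<And>u. nowhere_separable u \<Longrightarrow> u \<noteq> 0 \<Longrightarrow> thesis\<close>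
    unfolding nowhere_separable_def by blast
  define ok where "ok v \<longleftrightarrow> 0 \<le> v \<and> v \<noteq> 0 \<and> norm v \<le> 1 \<and> separable_set {0..v}" for v :: 'a
  define \<V> where "\<V> = {V. (\<forall>v\<in>V. ok v) \<and> (\<forall>v\<in>V. \<forall>w\<in>V. v \<noteq> w \<longrightarrow> inf v w = 0)}"
  have "\<exists>V\<in>\<V>. \<forall>X\<in>\<V>. V \<subseteq> X \<longrightarrow> X = V"
  proof (rule subset_Zorn')
    fix C assume "subset.chain \<V> C"
    then have C: "C \<subseteq> \<V>" "\<And>X Y. X \<in> C \<Longrightarrow> Y \<in> C \<Longrightarrow> X \<subseteq> Y \<or> Y \<subseteq> X"
      by (auto simp: subset_chain_def)
    have "inf v w = 0" if "v \<in> X" "w \<in> Y" "X \<in> C" "Y \<in> C" "v \<noteq> w" for v w X Y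
      using C(2)[of X Y] C(1) that unfolding \<V>_def by blast
    then show "\<Union>C \<in> \<V>" using C(1) unfolding \<V>_def by blast
  qed
  then obtain V where V: "V \<in> \<V>" and V_max: "\<And>X. X \<in> \<V> \<Longrightarrow> V \<subseteq> X \<Longrightarrow> X = V" by blast
  have ok: "ok v" if "v \<in> V" for v using V that by (simp add: \<V>_def)
  have disj: "inf v w = 0" if "v \<in> V" "w \<in> V" "v \<noteq> w" for v w using V that by (simp add: \<V>_def)
  have "countable V"
    using ok disj by (intro countable_disjoint_bounded[OF ocd]) (auto simp: ok_def)
  \<comment> \<open>Every member of \<open>V\<close> occurs infinitely often in the sequence \<open>e\<close>, so the partial sums of
    \<open>e\<close> eventually exceed every multiple of it. The element 0 is added in case \<open>V\<close> is empty.\<close>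
  define e where "e n = from_nat_into (insert 0 V) (fst (prod_decode n))" for n
  have e_in: "e n \<in> insert 0 V" for n unfolding e_def by (rule from_nat_into) simp
  have e_inf: "\<exists>n\<ge>k. e n = v" if v: "v \<in> V" for v k
  proof -
    obtain i where i: "from_nat_into (insert 0 V) i = v"
      using from_nat_into_surj[of "insert 0 V" v] \<open>countable V\<close> v by auto
    have "e (prod_encode (i, k)) = v" by (simp add: e_def i)
    moreover have "k \<le> prod_encode (i, k)" by (rule le_prod_encode_2)
    ultimately show ?thesis by blast
  qed
  have sep0: "separable_set {0::'a}" by (rule separable_setI[of "{0}"]) auto
  have e_pos: "0 \<le> e n" and e_sep: "separable_set {0..e n}" for n
    using e_in[of n] ok sep0 by (auto simp: ok_def)
  define s where "s k = (\<Sum>n<k. e n)" for k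
  have s_pos: "0 \<le> s k" for k unfolding s_def using e_pos by (rule sum_nonneg)
  have s_mono: "s j \<le> s k" if "j \<le> k" for j k
    unfolding s_def using that e_pos by (intro sum_mono2) auto
  have s_sep: "separable_set {0..s k}" for k
  proof (induction k)
    case (Suc k)
    then show ?case
      using separable_order_interval_add[OF Suc e_sep s_pos e_pos] by (simp add: s_def)
  qed (simp add: s_def sep0)
  have approx: "(\<lambda>k. inf x (s k)) \<longlonglongrightarrow> x" if x: "0 \<le> x" for x
  proof -
    have "incseq (\<lambda>k. inf x (s k))"
      unfolding incseq_def using s_mono by (intro allI impI inf_mono) auto
    then obtain y where y: "(\<lambda>k. inf x (s k)) \<longlonglongrightarrow> y" "\<And>k. inf x (s k) \<le> y" "y \<le> x"
      using order_continuous_norm_incseq_convergent[OF oc, of "\<lambda>k. inf x (s k)" x] by (metis inf_le1)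
    let ?w = "x - y"
    have w: "0 \<le> ?w" using y(3) by simp
    have w_disj: "inf ?w v = 0" if v: "v \<in> V" for v
    proof (rule order.antisym)
      let ?t = "inf ?w v"
      have "inf x (s k) + ?t \<le> y" for k
      proof -
        obtain n where n: "n \<ge> k" "e n = v" using e_inf[OF v] by blast
        have "s k + v \<le> s (Suc n)"
          using s_mono[OF n(1)] n(2) by (simp add: s_def add_right_mono)
        then have "inf x (s k) + ?t \<le> s (Suc n)"
          by (meson add_mono inf_le2 order_trans)
        moreover have "inf x (s k) + ?t \<le> y + ?w" by (intro add_mono y(2)) simp
        ultimately have "inf x (s k) + ?t \<le> inf x (s (Suc n))" by simp
        then show ?thesis using y(2) order_trans by blast
      qed
      then have "y + ?t \<le> y"
        by (intro lattice_tendsto_le[OF tendsto_add[OF y(1) tendsto_const] tendsto_const]) auto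
      then show "?t \<le> 0" by simp
      show "0 \<le> ?t" using w ok[OF v] by (simp add: ok_def)
    qed
    have "?w = 0"
    proof (rule ccontr)
      assume "?w \<noteq> 0"
      then obtain v where v: "0 \<le> v" "v \<le> ?w" "v \<noteq> 0" "separable_set {0..v}" using H[OF w] by blast
      \<comment> \<open>This factor brings the norm below 1 and is itself at most 1.\<close>
      let ?c = "1 / (1 + norm v)"
      have nv: "0 < 1 + norm v" by (simp add: add_pos_nonneg)
      then have c: "0 < ?c" "?c \<le> 1" by auto
      have cv: "0 \<le> ?c *\<^sub>R v" "?c *\<^sub>R v \<le> v"
        using v(1) c scaleR_right_mono[of ?c 1 v] by (auto intro: scaleR_nonneg_nonneg)
      have "ok (?c *\<^sub>R v)"
        unfolding ok_def using v cv c separable_set_subset[OF v(4)]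
        using nv by (auto simp: divide_le_eq)
      moreover have cd: "inf (?c *\<^sub>R v) v' = 0" if "v' \<in> V" for v'
      proof -
        have "inf (?c *\<^sub>R v) v' \<le> inf ?w v'" using cv(2) v(2) by (intro inf_mono) auto
        then show ?thesis
          using w_disj[OF that] cv(1) ok[OF that] by (intro order.antisym) (auto simp: ok_def)
      qed
      ultimately have "insert (?c *\<^sub>R v) V \<in> \<V>"
        using V unfolding \<V>_def by (auto simp: inf_commute)
      then have "?c *\<^sub>R v \<in> V" using V_max by blast
      then have "?c *\<^sub>R v = 0" using cd by fastforce
      then show False using v(3) c by simp
    qed
    then show ?thesis using y(1) by simp
  qed
  have "separable_set {x::'a. 0 \<le> x}"
  proof (rule separable_set_subset_closure)
    show "separable_set (\<Union>k. {0..s k})" by (rule separable_set_UN) (rule s_sep)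
    show "{x. 0 \<le> x} \<subseteq> closure (\<Union>k. {0..s k})"
    proof
      fix x :: 'a assume "x \<in> {x. 0 \<le> x}"
      then have x: "0 \<le> x" by simp
      then have "inf x (s k) \<in> {0..s k}" for k using s_pos by simp
      then have "inf x (s k) \<in> (\<Union>k. {0..s k})" for k by blast
      then show "x \<in> closure (\<Union>k. {0..s k})"
        using approx[OF x] unfolding closure_sequential by (intro exI[of _ "\<lambda>k. inf x (s k)"]) simp
    qed
  qed
  then have "separable_set ((\<lambda>(x, y). x - y) ` ({x::'a. 0 \<le> x} \<times> {x. 0 \<le> x}))"
    by (intro separable_set_image2) (auto simp: split_beta intro!: continuous_intros)
  moreover have "UNIV \<subseteq> (\<lambda>(x, y). x - y) ` ({x::'a. 0 \<le> x} \<times> {x. 0 \<le> x})"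
  proof
    fix x :: 'a
    show "x \<in> (\<lambda>(x, y). x - y) ` ({x::'a. 0 \<le> x} \<times> {x. 0 \<le> x})"
      by (rule image_eqI[of _ _ "(pprt x, pprt (- x))"]) (simp_all only: pprt_minus_pprt split, simp)
  qed
  ultimately show False using nonsep separable_set_subset by blast
qed

section \<open>Annihilated elements of full modulus\<close>

text \<open>Let \<open>K\<close> be the set of all \<open>z\<close> in \<open>[-u, u]\<close> annihilated by the sequence \<open>f\<close>. An extreme point
  \<open>z\<close> of \<open>K\<close> has modulus \<open>u\<close>: otherwise \<open>f\<close> annihilates some \<open>h \<noteq> 0\<close> with \<open>\<bar>h\<bar> \<le> u - \<bar>z\<bar>\<close>, because
  \<open>[0, u - \<bar>z\<bar>]\<close> is not separable, and \<open>z + h\<close> and \<open>z - h\<close> both lie in \<open>K\<close>. As in the proof of the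
  Krein--Milman theorem, \<open>z\<close> is taken from a minimal closed face of \<open>K\<close>. This is the idea of
  Lindenstrauss' proof of Lyapunov's convexity theorem.\<close>
lemma ex_annihilated_abs_eq:
  fixes f :: "nat \<Rightarrow> 'a \<Rightarrow>\<^sub>L real"
  assumes u: "nowhere_separable u"
  shows "\<exists>z. \<bar>z\<bar> = u \<and> (\<forall>n. blinfun_apply (f n) z = 0)"
proof -
  have u0: "0 \<le> u" using u by (simp add: nowhere_separable_def)
  define K where "K = {z. \<bar>z\<bar> \<le> u \<and> (\<forall>n. blinfun_apply (f n) z = 0)}"
  define face where "face G \<longleftrightarrow> (\<forall>z h. z \<in> G \<longrightarrow> z + h \<in> K \<longrightarrow> z - h \<in> K \<longrightarrow> z + h \<in> G \<and> z - h \<in> G)" for G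
  define \<G> where "\<G> = {G. G \<subseteq> K \<and> G \<noteq> {} \<and> closed G \<and> midpoint_closed G \<and> face G}"
  have K_le: "\<bar>z\<bar> \<le> u" if "z \<in> K" for z using that by (simp add: K_def)
  have K_in: "K \<in> \<G>"
  proof -
    have "K = {z. \<bar>z\<bar> \<le> u} \<inter> (\<Inter>n. {z. blinfun_apply (f n) z = 0})" by (auto simp: K_def)
    then have "closed K"
      by (auto intro!: closed_Int closed_INT closed_order_interval closed_Collect_eq continuous_intros)
    moreover have "midpoint_closed K"
      by (auto simp: K_def midpoint_closed_def blinfun.scaleR_right blinfun.add_right
          intro: abs_midpoint_le simp del: scaleR_add_right)
    moreover have "0 \<in> K" using u0 by (simp add: K_def)
    ultimately show ?thesis by (auto simp: \<G>_def face_def)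
  qed
  have Inter_in: "\<Inter>\<C> \<in> \<G>" if \<C>: "\<C> \<noteq> {}" "\<C> \<subseteq> \<G>" "\<And>C D. C \<in> \<C> \<Longrightarrow> D \<in> \<C> \<Longrightarrow> C \<subseteq> D \<or> D \<subseteq> C" for \<C>
  proof -
    have C: "C \<subseteq> K" "C \<noteq> {}" "closed C" "midpoint_closed C" "face C" if "C \<in> \<C>" for C
      using that \<C>(2) by (auto simp: \<G>_def)
    have "\<Inter>\<C> \<noteq> {}"
      by (rule chain_closed_midpoint_closed_Inter_nonempty[OF \<C>(1,3) C(2-4), of u]) (use C(1) K_le in auto)
    moreover have "closed (\<Inter>\<C>)" using C(3) by (intro closed_Inter) auto
    moreover have "midpoint_closed (\<Inter>\<C>)" using midpoint_closed_INT[of \<C> "\<lambda>C. C"] C(4) by simp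
    moreover have "face (\<Inter>\<C>)" using C(5) unfolding face_def by blast
    moreover have "\<Inter>\<C> \<subseteq> K" using \<C>(1) C(1) by blast
    ultimately show ?thesis by (simp add: \<G>_def)
  qed
  \<comment> \<open>Zorn's lemma provides maximal sets, hence the complements.\<close>
  have "\<exists>M\<in>uminus ` \<G>. \<forall>X\<in>uminus ` \<G>. M \<subseteq> X \<longrightarrow> X = M"
  proof (rule subset_Zorn_nonempty)
    show "uminus ` \<G> \<noteq> {}" using K_in by blast
    fix \<C> assume ne: "\<C> \<noteq> {}" and "subset.chain (uminus ` \<G>) \<C>"
    then have ch: "\<C> \<subseteq> uminus ` \<G>" "\<And>X Y. X \<in> \<C> \<Longrightarrow> Y \<in> \<C> \<Longrightarrow> X \<subseteq> Y \<or> Y \<subseteq> X"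
      by (auto simp: subset_chain_def)
    have "\<Inter>(uminus ` \<C>) \<in> \<G>"
    proof (rule Inter_in)
      show "uminus ` \<C> \<noteq> {}" using ne by simp
      show "uminus ` \<C> \<subseteq> \<G>" using ch(1) by auto
      show "C \<subseteq> D \<or> D \<subseteq> C" if "C \<in> uminus ` \<C>" "D \<in> uminus ` \<C>" for C D
        using that ch(2) by (auto simp: Compl_subset_Compl_iff)
    qed
    moreover have "\<Union>\<C> = - \<Inter>(uminus ` \<C>)" by auto
    ultimately show "\<Union>\<C> \<in> uminus ` \<G>" by blast
  qed
  then obtain G where G: "G \<in> \<G>" and G_min: "\<And>X. X \<in> \<G> \<Longrightarrow> X \<subseteq> G \<Longrightarrow> X = G"
    by (auto simp: Compl_subset_Compl_iff)
  have GK: "G \<subseteq> K" "closed G" "midpoint_closed G" "face G" using G by (auto simp: \<G>_def)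
  obtain z where z: "z \<in> G" using G by (auto simp: \<G>_def)
  \<comment> \<open>The points of \<open>G\<close> where \<open>g\<close> attains its maximum over \<open>G\<close> form a closed face, so
    they make up all of \<open>G\<close>.\<close>
  have const: "blinfun_apply g x = blinfun_apply g y" if "x \<in> G" "y \<in> G"
    for g :: "'a \<Rightarrow>\<^sub>L real" and x y
  proof -
    define m where "m = Sup (blinfun_apply g ` G)"
    have ba: "bdd_above (blinfun_apply g ` G)"
    proof (intro bdd_aboveI)
      fix r assume "r \<in> blinfun_apply g ` G"
      then obtain w where w: "w \<in> G" "r = blinfun_apply g w" by blast
      have "norm w \<le> norm u" using K_le GK(1) w(1) u0 by (intro norm_lattice) auto
      then have "norm g * norm w \<le> norm g * norm u" by (intro mult_left_mono) auto
      then show "r \<le> norm g * norm u" using norm_blinfun[of g w] w(2) by simp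
    qed
    have le_m: "blinfun_apply g w \<le> m" if "w \<in> G" for w
      unfolding m_def using that ba by (intro cSup_upper) auto
    define C where "C n = G \<inter> {w. m - inverse (real (Suc n)) \<le> blinfun_apply g w}" for n
    have anti: "C k \<subseteq> C j" if "j \<le> k" for j k
    proof -
      have "inverse (real (Suc k)) \<le> inverse (real (Suc j))"
        using that by (intro le_imp_inverse_le) auto
      then have "m - inverse (real (Suc j)) \<le> m - inverse (real (Suc k))"
        by (rule diff_left_mono)
      then show ?thesis unfolding C_def by (blast intro: order_trans)
    qed
    have "\<Inter>(range C) \<noteq> {}"
    proof (rule chain_closed_midpoint_closed_Inter_nonempty[of _ u])
      show "E \<subseteq> F \<or> F \<subseteq> E" if "E \<in> range C" "F \<in> range C" for E F
        using that anti by (metis imageE nat_le_linear)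
      show "E \<noteq> {}" if E: "E \<in> range C" for E
      proof -
        obtain n where n: "E = C n" using E by blast
        have "m - inverse (real (Suc n)) < m" by simp
        then obtain w where "w \<in> G" "m - inverse (real (Suc n)) < blinfun_apply g w"
          using less_cSup_iff[of "blinfun_apply g ` G" "m - inverse (real (Suc n))"] ba z
          unfolding m_def by auto
        then show ?thesis using n by (auto simp: C_def intro: less_imp_le)
      qed
      show "closed E" if "E \<in> range C" for E
        using that GK(2) unfolding C_def by (auto intro!: closed_Int closed_Collect_le continuous_intros)
      show "midpoint_closed E" if "E \<in> range C" for E
        using that GK(3) unfolding C_def by (auto intro!: midpoint_closed_Int midpoint_closed_half_space)
      show "\<bar>w\<bar> \<le> u" if "E \<in> range C" "w \<in> E" for E w
        using that GK(1) K_le by (auto simp: C_def)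
    qed simp
    then have C_ne: "\<exists>w. \<forall>n. w \<in> C n" by blast
    have C_eq: "(\<forall>n. w \<in> C n) \<longleftrightarrow> w \<in> G \<and> blinfun_apply g w = m" for w
    proof
      assume w: "\<forall>n. w \<in> C n"
      then have wG: "w \<in> G" by (auto simp: C_def)
      have "m - blinfun_apply g w \<le> inverse (real (Suc n))" for n
        using w by (auto simp: C_def algebra_simps)
      then have "m - blinfun_apply g w \<le> 0"
        using LIMSEQ_le_const[OF LIMSEQ_inverse_real_of_nat] by blast
      then show "w \<in> G \<and> blinfun_apply g w = m" using le_m[OF wG] wG by simp
    qed (auto simp: C_def)
    let ?X = "{w \<in> G. blinfun_apply g w = m}"
    have "?X \<in> \<G>"
    proof -
      have "?X \<noteq> {}" using C_ne C_eq by blast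
      moreover have "closed ?X"
        using GK(2) by (auto simp: Collect_conj_eq intro!: closed_Int closed_Collect_eq continuous_intros)
      moreover have "midpoint_closed ?X"
        using GK(3) by (simp add: midpoint_closed_def blinfun.scaleR_right blinfun.add_right)
      moreover have "face ?X"
        unfolding face_def
      proof (intro allI impI)
        fix w h assume w: "w \<in> ?X" and h: "w + h \<in> K" "w - h \<in> K"
        have "w + h \<in> G" "w - h \<in> G" using GK(4) w h by (auto simp: face_def)
        moreover have "blinfun_apply g (w + h) \<le> m" "blinfun_apply g (w - h) \<le> m"
          using calculation by (auto intro: le_m)
        ultimately show "w + h \<in> ?X \<and> w - h \<in> ?X"
          using w by (auto simp: blinfun.add_right blinfun.diff_right)
      qed
      ultimately show ?thesis using GK(1) by (auto simp: \<G>_def)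
    qed
    then have "?X = G" by (rule G_min) auto
    then have "blinfun_apply g w = m" if "w \<in> G" for w using that by blast
    then show ?thesis using that by simp
  qed
  have "\<bar>z\<bar> = u"
  proof (rule ccontr)
    assume ne: "\<bar>z\<bar> \<noteq> u"
    let ?v = "u - \<bar>z\<bar>"
    have zK: "z \<in> K" using z GK(1) by blast
    have v: "0 \<le> ?v" "?v \<le> u" "?v \<noteq> 0" using K_le[OF zK] ne by auto
    have "\<not> separable_set {0..?v}" using u v unfolding nowhere_separable_def by blast
    then obtain h where h: "\<bar>h\<bar> \<le> ?v" "\<And>n. blinfun_apply (f n) h = 0" "h \<noteq> 0"
      using separating_imp_separable_interval[of ?v f] by blast
    have in_K: "z + k \<in> K" if "\<bar>k\<bar> = \<bar>h\<bar>" "\<And>n. blinfun_apply (f n) k = 0" for k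
    proof -
      have "\<bar>z + k\<bar> \<le> \<bar>z\<bar> + \<bar>k\<bar>" by (rule abs_triangle_ineq)
      also have "\<dots> \<le> \<bar>z\<bar> + ?v" using h(1) that(1) by (intro add_left_mono) simp
      finally show ?thesis using zK that(2) by (simp add: K_def blinfun.add_right)
    qed
    have "z + h \<in> K" "z - h \<in> K"
      using in_K[of h] in_K[of "- h"] h(2) by (auto simp: blinfun.minus_right)
    then have "z + h \<in> G" using GK(4) z by (auto simp: face_def)
    then have g0: "blinfun_apply g h = 0" for g :: "'a \<Rightarrow>\<^sub>L real"
      using const[OF _ z, of "z + h" g] by (simp add: blinfun.add_right)
    \<comment> \<open>Restricting \<open>\<phi>\<close> to the band of its positive part separates a nonzero element from 0.\<close>
    have pprt0: "pprt k = 0" if "\<And>g :: 'a \<Rightarrow>\<^sub>L real. blinfun_apply g k = 0" for k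
    proof -
      have "blinfun_apply (band_proj (pprt k)) k
          = blinfun_apply (band_proj (pprt k)) (pprt k) - blinfun_apply (band_proj (pprt k)) (pprt (- k))"
        by (simp only: blinfun.diff_right[symmetric] pprt_minus_pprt)
      also have "\<dots> = pprt k"
        using band_proj_self[OF oc, of "pprt k"] band_proj_disjoint[OF oc, of "pprt k" "pprt (- k)"]
          pprt_disjoint[of k] by (simp add: inf_commute)
      finally have "blinfun_apply \<phi> (pprt k) = 0"
        using that[of "\<phi> o\<^sub>L band_proj (pprt k)"] by simp
      then show ?thesis by (intro strict) auto
    qed
    have "pprt h = 0" "pprt (- h) = 0" using g0 by (auto intro!: pprt0 simp: blinfun.minus_right)
    then show False using h(3) pprt_minus_pprt[of h] by simp
  qed
  then show ?thesis using z GK(1) by (auto simp: K_def)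
qed

end

section \<open>Separability of the lattice\<close>

theorem theorem4p6:
  assumes "order_continuous_norm ((\<le>) :: 'a::banach_lattice \<Rightarrow> 'a \<Rightarrow> bool)"
    and "order_continuous_norm (dual_le :: ('a \<Rightarrow>\<^sub>L real) \<Rightarrow> ('a \<Rightarrow>\<^sub>L real) \<Rightarrow> bool)"
    and "\<exists>B :: ('a \<Rightarrow>\<^sub>L real) set. countable B \<and> positively_norming B"
  shows "separable_space (euclidean :: 'a topology)"
proof (rule ccontr)
  assume "\<not> ?thesis"
  then have nonsep: "\<not> separable_set (UNIV :: 'a set)"
    unfolding separable_space_def separable_set_def by auto
  obtain B :: "('a \<Rightarrow>\<^sub>L real) set" where B: "countable B" "positively_norming B"
    using assms(3) by blast
  obtain \<phi> :: "'a \<Rightarrow>\<^sub>L real" where "dual_le 0 \<phi>"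
    "\<And>x. 0 \<le> x \<Longrightarrow> blinfun_apply \<phi> x = 0 \<Longrightarrow> x = 0"
    using positively_norming_ex_strictly_positive[OF B] by blast
  then interpret strictly_positive_functional \<phi>
    using assms(1) by unfold_locales auto
  obtain u :: 'a where u: "nowhere_separable u" "u \<noteq> 0"
    using ex_nowhere_separable[OF assms(2) nonsep] by blast
  have u0: "0 \<le> u" using u(1) by (simp add: nowhere_separable_def)
  define f where "f = from_nat_into B"
  have ne: "B \<noteq> {}" and B_sub: "B \<subseteq> cball 0 1 \<inter> {\<phi>. dual_le 0 \<phi>}"
    using B(2) by (auto simp: positively_norming_def)
  obtain c where c: "0 < c" "\<And>x. norm x \<le> c * (SUP \<phi>\<in>B. blinfun_apply \<phi> \<bar>x\<bar>)"
    using B(2) by (auto simp: positively_norming_def)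
  have f_B: "f n \<in> B" for n unfolding f_def using ne by (rule from_nat_into)
  have f_surj: "\<exists>n. \<psi> = f n" if "\<psi> \<in> B" for \<psi>
    unfolding f_def using from_nat_into_surj[OF B(1) that] by metis
  have f_pos: "dual_le 0 (f n)" and f_norm: "norm (f n) \<le> 1" for n
    using f_B[of n] B_sub by auto
  obtain Z where Z: "\<And>v. nowhere_separable v \<Longrightarrow> \<bar>Z v\<bar> = v"
    "\<And>v n. nowhere_separable v \<Longrightarrow> blinfun_apply (f n) (Z v) = 0"
    using ex_annihilated_abs_eq[of _ f] by metis
  \<comment> \<open>At each step \<open>U k\<close> splits into the disjoint parts \<open>U (Suc k)\<close> and \<open>w k\<close>, at which every
    member of the norming set takes the same value. Scaling \<open>w k\<close> by \<open>2 ^ Suc k\<close> yields a bounded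
    disjoint sequence on which all these functionals are constant.\<close>
  define U where "U = rec_nat u (\<lambda>_ v. pprt (Z v))"
  have U_0: "U 0 = u" and U_Suc: "U (Suc k) = pprt (Z (U k))" for k by (simp_all add: U_def)
  define w where "w k = pprt (- Z (U k))" for k
  have ns: "nowhere_separable (U k)" for k
  proof (induction k)
    case (Suc k)
    have "pprt (Z (U k)) \<le> U k" using pprt_le_abs[of "Z (U k)"] Z(1)[OF Suc] by simp
    then show ?case unfolding U_Suc by (intro nowhere_separable_le[OF Suc]) auto
  qed (simp add: U_0 u)
  have U_add: "U (Suc k) + w k = U k" for k
    using pprt_plus_pprt[of "Z (U k)"] Z(1)[OF ns] by (simp add: U_Suc w_def)
  have w_pos: "0 \<le> w k" for k by (simp add: w_def)
  have U_pos: "0 \<le> U k" for k using ns by (simp add: nowhere_separable_def)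
  have fw: "blinfun_apply (f n) (w k) = blinfun_apply (f n) (U (Suc k))" for n k
  proof -
    have "blinfun_apply (f n) (pprt (Z (U k)) - pprt (- Z (U k))) = 0"
      by (simp only: pprt_minus_pprt Z(2)[OF ns])
    then show ?thesis by (simp add: blinfun.diff_right U_Suc w_def)
  qed
  have fU: "blinfun_apply (f n) (U k) = (1/2) ^ k * blinfun_apply (f n) u" for n k
  proof (induction k)
    case (Suc k)
    have "blinfun_apply (f n) (U (Suc k)) + blinfun_apply (f n) (w k) = blinfun_apply (f n) (U k)"
      by (simp only: blinfun.add_right[symmetric] U_add)
    then show ?case using fw[of n k] Suc by simp
  qed (simp add: U_0)
  define W where "W k = (2 ^ Suc k) *\<^sub>R w k" for k
  have W_pos: "0 \<le> W k" for k unfolding W_def using w_pos by (intro scaleR_nonneg_nonneg) auto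
  have fW: "blinfun_apply (f n) (W k) = blinfun_apply (f n) u" for n k
    unfolding W_def by (simp add: blinfun.scaleR_right fw fU power_one_over)
  have U_anti: "U k \<le> U j" if "j \<le> k" for j k
    using that
  proof (induction k rule: dec_induct)
    case (step k)
    have "U (Suc k) \<le> U k" unfolding U_add[of k, symmetric] using w_pos[of k] by simp
    then show ?case using step by (simp add: order_trans)
  qed simp
  have disj_less: "inf (W j) (W k) = 0" if "j < k" for j k
  proof -
    have "w k \<le> U k" using U_add[of k] U_pos[of "Suc k"] by (metis add_increasing order_refl)
    also have "\<dots> \<le> U (Suc j)" using that by (intro U_anti) simp
    finally have "inf (w k) (w j) \<le> inf (U (Suc j)) (w j)" by (intro inf_mono) auto
    also have "\<dots> = 0" unfolding U_Suc w_def by (rule pprt_disjoint)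
    finally have "inf (w k) (w j) = 0" using w_pos by (intro order.antisym) auto
    then have "inf (W k) (w j) = 0"
      unfolding W_def using w_pos by (intro disjoint_scaleR) auto
    then show ?thesis
      unfolding W_def[of j] using w_pos W_pos by (intro disjoint_scaleR) (auto simp: inf_commute)
  qed
  have W_disj: "inf (W j) (W k) = 0" if "j \<noteq> k" for j k
    using disj_less[of j k] disj_less[of k j] that by (metis inf_commute nat_neq_iff)
  have W_norm: "norm (W k) \<le> c * norm u" for k
  proof -
    have "(SUP \<psi>\<in>B. blinfun_apply \<psi> \<bar>W k\<bar>) \<le> norm u"
    proof (rule cSUP_least[OF ne])
      fix \<psi> assume "\<psi> \<in> B"
      then obtain n where n: "\<psi> = f n" using f_surj by blast
      have "blinfun_apply \<psi> \<bar>W k\<bar> = blinfun_apply (f n) u" using W_pos[of k] by (simp add: n fW)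
      also have "\<dots> \<le> norm (f n) * norm u" using norm_blinfun[of "f n" u] by simp
      also have "\<dots> \<le> norm u" using f_norm[of n] by (simp add: mult_left_le_one_le)
      finally show "blinfun_apply \<psi> \<bar>W k\<bar> \<le> norm u" .
    qed
    then show ?thesis using c(2)[of "W k"] c(1) by (meson mult_left_mono less_imp_le order_trans)
  qed
  obtain n where n: "blinfun_apply (f n) u \<noteq> 0"
  proof (rule ccontr)
    assume no: "\<not> thesis"
    have "blinfun_apply \<psi> \<bar>u\<bar> = 0" if "\<psi> \<in> B" for \<psi>
      using f_surj[OF that] no \<open>\<And>n. blinfun_apply (f n) u \<noteq> 0 \<Longrightarrow> thesis\<close> u0 by auto
    then have "(SUP \<psi>\<in>B. blinfun_apply \<psi> \<bar>u\<bar>) = 0" using ne by simp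
    then have "norm u \<le> 0" using c(2)[of u] by simp
    then show False using u(2) by simp
  qed
  then have "0 < blinfun_apply (f n) u" using blinfun_nonneg[OF f_pos u0, of n] by simp
  then have "\<exists>k. blinfun_apply (f n) (W k) < blinfun_apply (f n) u"
    using W_disj by (intro dual_order_continuous_disjoint_small[OF assms(1,2) f_pos W_pos _ W_norm]) auto
  then show False by (simp add: fW)
qed

end
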